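(* Let $Q$ be an $m$-gon ($m\ge 2$), let $\lambda$ be a characteristic function on $Q$ with $\lambda(F_k)=a_k\epsilon_1+b_k\epsilon_2$ ($1\le k\le m$), and let $X=X(Q,\lambda)$ be the associated $4$-dimensional torus orbifold. Suppose that $$\mathrm{span}_{\mathbb{Z}}\{a_k\epsilon_1+b_k\epsilon_2\mid k=1,\dots,m\}=H_2(BT)\quad\text{or}\quad \gcd\{D_1,\dots,D_m\}=1,$$ where $D_k=a_kb_{k+1}-b_ka_{k+1}$ (indices modulo $m$). Then $H^\ast_T(X)$ (identified with the weighted face ring $\mathbb{Z}[\Gamma,\alpha]$ of the orbifold torus graph of $(Q,\lambda)$) is generated by the union of (i) $\left\{\sum_{1\le i\le m}c_ix_{F_i}\ \Big|\ (c_1,\dots,c_m)\in\bigcap_{k=1}^m\mathbb{L}_k^{\deg 2}\right\}$; (ii) $\left\{\sum_{t=0,1;\ 1\le i\le m}c_{t,i}\,x_{F_i}^{2-t}x_{F_{i+1}}^t\ \Big|\ (c_{0,1},c_{1,1},c_{0,2},c_{1,2},\dots,c_{0,m},c_{1,m})\in\bigcap_{k=1}^m\mathbb{L}_k^{\deg 4}\right\}$.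
   Context: $T=T^2$; cohomology has integer coefficients unless stated otherwise. $H_2(BT)=\mathrm{Hom}(S^1,T)\cong\mathbb{Z}^2$ has basis $\epsilon_1,\epsilon_2$, and $H^2(BT)=\mathrm{Hom}(T,S^1)$ has dual basis $\epsilon_1^*,\epsilon_2^*$. $Q$ is an $m$-gon: a $2$-dimensional manifold with faces (a disc) with $m$ sides (facets) $F_1,\dots,F_m$ and $m$ vertices $v_1,\dots,v_m$ in cyclic order, $v_k=F_k\cap F_{k+1}$, where the index $m+1$ is identified with $1$ (for $m=2$ the two sides share both vertices $v_1,v_2$). A characteristic function $\lambda\colon\{F_1,\dots,F_m\}\to H_2(BT)$ is a function with $\lambda(F_k)\ne0$ and $\lambda(F_k),\lambda(F_{k+1})$ linearly independent for all $k$. $X(Q,\lambda)=(Q\times T)/\!\sim$, where $(x,t)\sim(y,s)$ iff $x=y$ and $t^{-1}s\in T_{F(x)}$, $F(x)$ being the face containing $x$ in its relative interior and $T_{F(x)}$ the subtorus generated by the circles $\lambda(F_i)(S^1)$ for the facets $F_i\supseteq F(x)$; $T$ acts on the second factor. Orbifold torus graph: $\Gamma$ has vertices $v_1,\dots,v_m$ and oriented edges $e_k,\overline e_k$, where $e_k=F_k$ with initial vertex $v_{k-1}$ and $\overline e_k$ is its reverse, and $\alpha(e_k)=\frac{1}{D_{k-1}}(b_k\epsilon_1^*-a_k\epsilon_2^* )$, $\alpha(\overline e_k)=\frac{1}{D_k}(-b_k\epsilon_1^*+a_k\epsilon_2^* )$ in $H^2(BT;\mathbb{Q})$. Its faces are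 the vertices, the edges $F_k$, and $\Gamma$; $\mathcal{F}$ is the set of faces. Weighted face ring: for a face $F$ let $\tau_F(v)$ be the product of $\alpha(e)$ over oriented edges $e$ with initial vertex $v$ not contained in $F$ if $v\in F$, and $\tau_F(v)=0$ if $v\notin F$. Let $x_F$ be formal generators of degree $2(2-\dim F)$, $x_\Gamma=1$, $x_\emptyset=0$, and let $\mu$ be the ring homomorphism from $\mathbb{Q}[x_F\mid F\in\mathcal{F}]$ to functions $\{v_1,\dots,v_m\}\to H^*(BT;\mathbb{Q})$ with $\mu(x_F)=\tau_F$. Put $\mathscr{Z}_{\Gamma,\alpha}=\{f\in\mathbb{Z}[x_F\mid F\in\mathcal{F}]\mid\mu(f)(v)\in H^*(BT)\text{ for all vertices }v\}$, let $\mathcal{I}$ be the ideal of $\mathscr{Z}_{\Gamma,\alpha}$ generated by all $x_Fx_E-x_{E\vee F}\sum_{G\in E\cap F}x_G$ ($E\vee F$ the minimal face containing $E$ and $F$; $G$ runs over the connected components of $E\cap F$; the element is $x_Fx_E$ if $E\cap F=\emptyset$), and $\mathbb{Z}[\Gamma,\alpha]=\mathscr{Z}_{\Gamma,\alpha}/\mathcal{I}$. Under the hypotheses $H^{odd}(X)=0$ and $H_T^*(X)\cong\mathbb{Z}[\Gamma,\alpha]$ as $H^*(BT)$-algebras. "Generated" means as a ring, and the elements in (i), (ii) stand for their classes in $\mathbb{Z}[\Gamma,\alpha]$. Lattices: for $A=\begin{bmatrix} a & b \\ c & d \end{bmatrix}$, $\Phi^{(n)}(A)$ is the $(n+1)\times(n+1)$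 matrix whose $(t+1)$-st row ($0\le t\le n$) lists the coefficients of $(ar+bs)^{n-t}(cr+ds)^t$ with respect to the ordered basis $r^n,r^{n-1}s,\dots,s^n$; thus $\Phi^{(1)}(A)=A$ and $$\Phi^{(2)}(A)=\begin{bmatrix} a^2 & 2ab & b^2 \\ ac & ad+bc & bd \\ c^2 & 2cd & d^2 \end{bmatrix}.$$ Let $\Lambda_k=\begin{bmatrix} a_k & a_{k+1} \\ b_k & b_{k+1} \end{bmatrix}$ for $1\le k\le m$ (with $a_{m+1}=a_1$, $b_{m+1}=b_1$). For $n\ge1$ define $nm\times nm$ matrices: $\tilde\Lambda_k^{(n)}$ is the block diagonal matrix with diagonal blocks $I_{n(k-1)},\ \Phi^{(n)}(\Lambda_k),\ I_{n(m-k)-1}$ for $1\le k\le m-1$; and $$\tilde\Lambda_m^{(n)}=\begin{bmatrix} \mathbf{0} & I_{n(m-1)-1} & \mathbf{0} \\ \mathfrak{s}_{n+1} & \mathbf{0} & \mathfrak{s}_1\ \cdots\ \mathfrak{s}_n \end{bmatrix},$$ where $\mathfrak{s}_i$ is the $i$-th column of $\Phi^{(n)}(\Lambda_m)$. $\mathbb{L}_k^{\deg 2n}$ is the sublattice of $\mathbb{Z}^{nm}$ spanned by the row vectors of $\tilde\Lambda_k^{(n)}$.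
   Formalization: The ideal I is generated by the relations in Z[x_F | F], not only with factors from Z_{Γ,α} (false for λ=(1,0),(1,2),(-1,2),(-1,0),(0,-1)); for m=2 the mixed monomial x_{F_i}x_{F_{i+1}} in (ii) is replaced by x_{v_i}, as the literal m=2 case fails. *)

theory Defs
  imports
    "HOL-Algebra.QuotRing"
    "HOL-Algebra.Generated_Rings"
    "HOL-Library.Poly_Mapping"
    "HOL-Library.Product_Plus"
    "HOL-Computational_Algebra.Polynomial"
    "Jordan_Normal_Form.Matrix"
begin

hide_const (open) Multiset.mult

text \<open>
  The sides and the vertices of the \<open>m\<close>-gon are indexed by \<open>{1..m}\<close>, cyclically:
  \<open>v\<^sub>k = F\<^sub>k \<inter> F\<^bsub>k+1\<^esub>\<close>.  The pair \<open>(p, q)\<close> of integers stands for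
  \<open>p \<epsilon>\<^sub>1 + q \<epsilon>\<^sub>2\<close> in \<open>H\<^sub>2(BT)\<close>.
\<close>

definition nxt :: "nat \<Rightarrow> nat \<Rightarrow> nat" where
  "nxt m k = (if k = m then 1 else k + 1)"

definition prv :: "nat \<Rightarrow> nat \<Rightarrow> nat" where
  "prv m k = (if k = 1 then m else k - 1)"

definition zscale :: "int \<Rightarrow> int \<times> int \<Rightarrow> int \<times> int" where
  "zscale c u = (c * fst u, c * snd u)"

lemma module_zscale: "Modules.module zscale"
  by standard (auto simp: zscale_def algebra_simps)

definition characteristic_function :: "nat \<Rightarrow> (nat \<Rightarrow> int \<times> int) \<Rightarrow> bool" where
  "characteristic_function m lam \<longleftrightarrow>
     (\<forall>k\<in>{1..m}. lam k \<noteq> 0 \<and>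
        (\<forall>p q. zscale p (lam k) + zscale q (lam (nxt m k)) = 0 \<longrightarrow> p = 0 \<and> q = 0))"

definition ca :: "(nat \<Rightarrow> int \<times> int) \<Rightarrow> nat \<Rightarrow> int" where "ca lam k = fst (lam k)"
definition cb :: "(nat \<Rightarrow> int \<times> int) \<Rightarrow> nat \<Rightarrow> int" where "cb lam k = snd (lam k)"

definition DD :: "nat \<Rightarrow> (nat \<Rightarrow> int \<times> int) \<Rightarrow> nat \<Rightarrow> int" where
  "DD m lam k = ca lam k * cb lam (nxt m k) - cb lam k * ca lam (nxt m k)"

text \<open>
  \<open>H\<^sup>*(BT; \<rat>) = \<rat>[\<epsilon>\<^sub>1\<^sup>*, \<epsilon>\<^sub>2\<^sup>*]\<close> is modelled by \<^typ>\<open>rat poly poly\<close>;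
  \<open>H\<^sup>*(BT)\<close> is the subring of the polynomials with integer coefficients.
\<close>

definition eps1 :: "rat poly poly" where "eps1 = [:[:0, 1:]:]"
definition eps2 :: "rat poly poly" where "eps2 = [:0, 1:]"

definition HBT :: "rat poly poly set" where
  "HBT = {p. \<forall>i j. Polynomial.coeff (Polynomial.coeff p i) j \<in> \<int>}"

definition lin_form :: "rat \<Rightarrow> rat \<Rightarrow> rat poly poly" where
  "lin_form p q = [:[:p:]:] * eps1 + [:[:q:]:] * eps2"

text \<open>\<open>Fwd k\<close> is \<open>e\<^sub>k\<close>, oriented from \<open>v\<^bsub>k-1\<^esub>\<close> to \<open>v\<^sub>k\<close>, and \<open>Rev k\<close> is its reverse.\<close>

datatype oedge = Fwd nat | Rev nat

definition oedges :: "nat \<Rightarrow> oedge set" where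
  "oedges m = Fwd ` {1..m} \<union> Rev ` {1..m}"

fun init_vertex :: "nat \<Rightarrow> oedge \<Rightarrow> nat" where
  "init_vertex m (Fwd k) = prv m k"
| "init_vertex m (Rev k) = k"

fun side :: "oedge \<Rightarrow> nat" where
  "side (Fwd k) = k"
| "side (Rev k) = k"

fun axial :: "nat \<Rightarrow> (nat \<Rightarrow> int \<times> int) \<Rightarrow> oedge \<Rightarrow> rat poly poly" where
  "axial m lam (Fwd k) =
     [:[:1 / of_int (DD m lam (prv m k)):]:] * lin_form (of_int (cb lam k)) (- of_int (ca lam k))"
| "axial m lam (Rev k) =
     [:[:1 / of_int (DD m lam k):]:] * lin_form (- of_int (cb lam k)) (of_int (ca lam k))"

text \<open>A face is a subgraph, given by its vertices and its (unoriented) edges.\<close>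

datatype face = Vertex nat | Edge nat | Whole

definition faces :: "nat \<Rightarrow> face set" where
  "faces m = Vertex ` {1..m} \<union> Edge ` {1..m} \<union> {Whole}"

fun fverts :: "nat \<Rightarrow> face \<Rightarrow> nat set" where
  "fverts m (Vertex k) = {k}"
| "fverts m (Edge k) = {prv m k, k}"
| "fverts m Whole = {1..m}"

fun fedges :: "nat \<Rightarrow> face \<Rightarrow> nat set" where
  "fedges m (Vertex k) = {}"
| "fedges m (Edge k) = {k}"
| "fedges m Whole = {1..m}"

definition face_le :: "nat \<Rightarrow> face \<Rightarrow> face \<Rightarrow> bool" where
  "face_le m E F \<longleftrightarrow> fverts m E \<subseteq> fverts m F \<and> fedges m E \<subseteq> fedges m F"

definition face_join :: "nat \<Rightarrow> face \<Rightarrow> face \<Rightarrow> face" where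
  "face_join m E F = (THE G. G \<in> faces m \<and> face_le m E G \<and> face_le m F G \<and>
     (\<forall>H\<in>faces m. face_le m E H \<and> face_le m F H \<longrightarrow> face_le m G H))"

text \<open>
  The connected components of the subgraph \<open>E \<inter> F\<close>.  All of them are faces, so they are
  collected as elements of \<^const>\<open>faces\<close>: a component is the subgraph of \<open>E \<inter> F\<close> induced on the
  set of all vertices reachable, along edges of \<open>E \<inter> F\<close>, from one of its vertices.
\<close>

definition inter_adj :: "nat \<Rightarrow> face \<Rightarrow> face \<Rightarrow> (nat \<times> nat) set" where
  "inter_adj m E F =
     {(u, v). \<exists>k \<in> fedges m E \<inter> fedges m F. {u, v} = {prv m k, k}}"

definition components :: "nat \<Rightarrow> face \<Rightarrow> face \<Rightarrow> face set" where
  "components m E F = {G \<in> faces m. \<exists>v \<in> fverts m E \<inter> fverts m F.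
     fverts m G = (inter_adj m E F)\<^sup>* `` {v} \<and>
     fedges m G = {k \<in> fedges m E \<inter> fedges m F. {prv m k, k} \<subseteq> fverts m G}}"

definition tau :: "nat \<Rightarrow> (nat \<Rightarrow> int \<times> int) \<Rightarrow> face \<Rightarrow> nat \<Rightarrow> rat poly poly" where
  "tau m lam F v =
     (if v \<in> fverts m F
      then \<Prod>e\<in>{e \<in> oedges m. init_vertex m e = v \<and> side e \<notin> fedges m F}. axial m lam e
      else 0)"

text \<open>
  Polynomials with integer coefficients in variables indexed by \<^typ>\<open>face\<close>.  Since \<open>x\<^sub>\<Gamma> = 1\<close>,
  the variable of \<^const>\<open>Whole\<close> is excluded from \<open>\<int>[x\<^sub>F | F]\<close>.
\<close>

type_synonym zpoly = "(face \<Rightarrow>\<^sub>0 nat) \<Rightarrow>\<^sub>0 int"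

definition xg :: "face \<Rightarrow> zpoly" where
  "xg F = (if F = Whole then 1 else Poly_Mapping.single (Poly_Mapping.single F 1) 1)"

definition zconst :: "int \<Rightarrow> zpoly" where
  "zconst c = Poly_Mapping.single 0 c"

definition face_poly_ring :: "nat \<Rightarrow> zpoly ring" where
  "face_poly_ring m =
     \<lparr>carrier = {f. \<forall>u \<in> Poly_Mapping.keys f. Poly_Mapping.keys u \<subseteq> faces m - {Whole}},
      mult = (*), one = 1, zero = 0, add = (+)\<rparr>"

definition mu :: "nat \<Rightarrow> (nat \<Rightarrow> int \<times> int) \<Rightarrow> zpoly \<Rightarrow> nat \<Rightarrow> rat poly poly" where
  "mu m lam f v = (\<Sum>u \<in> Poly_Mapping.keys f. of_int (Poly_Mapping.lookup f u) *
     (\<Prod>F \<in> Poly_Mapping.keys u. tau m lam F v ^ Poly_Mapping.lookup u F))"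

definition ZGa :: "nat \<Rightarrow> (nat \<Rightarrow> int \<times> int) \<Rightarrow> zpoly ring" where
  "ZGa m lam = (face_poly_ring m)
     \<lparr>carrier := {f \<in> carrier (face_poly_ring m). \<forall>v\<in>{1..m}. mu m lam f v \<in> HBT}\<rparr>"

definition face_relation :: "nat \<Rightarrow> face \<Rightarrow> face \<Rightarrow> zpoly" where
  "face_relation m E F =
     (if fverts m E \<inter> fverts m F = {} then xg F * xg E
      else xg F * xg E - xg (face_join m E F) * (\<Sum>G\<in>components m E F. xg G))"

text \<open>
  The multiples of the relations are taken with arbitrary factors from \<open>\<int>[x\<^sub>F | F]\<close>.  All relations
  are killed by \<open>\<mu>\<close>, so this ideal of \<open>\<int>[x\<^sub>F | F]\<close> is contained in \<open>ZGa\<close> and is an ideal of it.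
  Factors from \<open>ZGa\<close> alone do not suffice: for \<open>m = 5\<close> and
  \<open>\<lambda> = (1,0), (1,2), (-1,2), (-1,0), (0,-1)\<close> the element \<open>x\<^bsub>F1\<^esub>\<^sup>2 x\<^bsub>F3\<^esub>\<close> of the kernel of \<open>\<mu>\<close> would
  survive as a torsion class in the quotient, which could then not be \<open>H\<^sub>T\<^sup>*(X)\<close>.
\<close>

definition face_ideal :: "nat \<Rightarrow> zpoly set" where
  "face_ideal m = genideal (face_poly_ring m) {face_relation m E F | E F. E \<in> faces m \<and> F \<in> faces m}"

definition weighted_face_ring :: "nat \<Rightarrow> (nat \<Rightarrow> int \<times> int) \<Rightarrow> zpoly set ring" where
  "weighted_face_ring m lam = ZGa m lam Quot face_ideal m"

definition face_class :: "nat \<Rightarrow> (nat \<Rightarrow> int \<times> int) \<Rightarrow> zpoly \<Rightarrow> zpoly set" where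
  "face_class m lam f = face_ideal m +>\<^bsub>ZGa m lam\<^esub> f"

text \<open>
  Homogeneous polynomials of degree \<open>n\<close> in \<open>r, s\<close> are dehomogenised by \<open>r = 1\<close>: the coefficient of
  \<open>r\<^bsup>n-j\<^esup> s\<^sup>j\<close> is the \<open>j\<close>-th coefficient in \<open>s\<close>.  Matrix indices start from 0.
\<close>

definition Phi :: "nat \<Rightarrow> int mat \<Rightarrow> int mat" where
  "Phi n A = Matrix.mat (n + 1) (n + 1) (\<lambda>(t, j). Polynomial.coeff
     ([:A $$ (0, 0), A $$ (0, 1):] ^ (n - t) * [:A $$ (1, 0), A $$ (1, 1):] ^ t) j)"

definition Lam :: "nat \<Rightarrow> (nat \<Rightarrow> int \<times> int) \<Rightarrow> nat \<Rightarrow> int mat" where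
  "Lam m lam k = mat_of_rows_list 2
     [[ca lam k, ca lam (nxt m k)], [cb lam k, cb lam (nxt m k)]]"

definition tilde_Lam :: "nat \<Rightarrow> (nat \<Rightarrow> int \<times> int) \<Rightarrow> nat \<Rightarrow> nat \<Rightarrow> int mat" where
  "tilde_Lam m lam n k =
     (if k < m
      then diag_block_mat [1\<^sub>m (n * (k - 1)), Phi n (Lam m lam k), 1\<^sub>m (n * (m - k) - 1)]
      else let N = n * (m - 1) - 1; S = Phi n (Lam m lam m) in
        Matrix.mat (n * m) (n * m) (\<lambda>(i, j).
          if i < N then (if j = i + 1 then 1 else 0)
          else if j = 0 then S $$ (i - N, n)
          else if j \<le> N then 0
          else S $$ (i - N, j - (N + 1))))"

definition LL :: "nat \<Rightarrow> (nat \<Rightarrow> int \<times> int) \<Rightarrow> nat \<Rightarrow> nat \<Rightarrow> int Matrix.vec set" where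
  "LL m lam n k =
     {transpose_mat (tilde_Lam m lam n k) *\<^sub>v w | w. w \<in> carrier_vec (n * m)}"

definition generators2 :: "nat \<Rightarrow> (nat \<Rightarrow> int \<times> int) \<Rightarrow> zpoly set" where
  "generators2 m lam =
     {(\<Sum>i\<in>{1..m}. zconst (c $ (i - 1)) * xg (Edge i)) | c. c \<in> (\<Inter>k\<in>{1..m}. LL m lam 1 k)}"

text \<open>
  For \<open>m = 2\<close> the intersection \<open>F\<^sub>1 \<inter> F\<^sub>2\<close> has the two components \<open>v\<^sub>1\<close> and \<open>v\<^sub>2\<close>, and
  \<open>x\<^bsub>F1\<^esub> x\<^bsub>F2\<^esub> = x\<^bsub>v1\<^esub> + x\<^bsub>v2\<^esub>\<close> in the face ring.  The mixed monomial with index \<open>i\<close> belongs to the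
  vertex \<open>v\<^sub>i\<close>, so there it denotes the summand \<open>x\<^bsub>vi\<^esub>\<close>.  (With the full product, the generators
  for \<open>m = 2\<close> would be polynomials in \<open>x\<^bsub>F1\<^esub>, x\<^bsub>F2\<^esub>\<close>, which \<open>\<mu>\<close> maps to constant functions on the
  vertices, so the class of \<open>x\<^bsub>v1\<^esub>\<close> could not be reached.)  For \<open>m \<ge> 3\<close> the product \<open>x\<^bsub>Fi\<^esub> x\<^bsub>F(i+1)\<^esub>\<close>
  equals \<open>x\<^bsub>vi\<^esub>\<close> in the face ring anyway.
\<close>

definition quad_monomial :: "nat \<Rightarrow> nat \<Rightarrow> nat \<Rightarrow> zpoly" where
  "quad_monomial m t i =
     (if m = 2 \<and> t = 1 then xg (Vertex i)
      else xg (Edge i) ^ (2 - t) * xg (Edge (nxt m i)) ^ t)"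

definition generators4 :: "nat \<Rightarrow> (nat \<Rightarrow> int \<times> int) \<Rightarrow> zpoly set" where
  "generators4 m lam =
     {(\<Sum>t\<in>{0, 1}. \<Sum>i\<in>{1..m}. zconst (c $ (2 * (i - 1) + t)) * quad_monomial m t i)
        | c. c \<in> (\<Inter>k\<in>{1..m}. LL m lam 2 k)}"

end

theory Submission
  imports Defs
begin

text \<open>
  Restriction to the vertices identifies the weighted face ring with the ring of piecewise
  polynomials: families of integral polynomials \<open>p\<^sub>1, \<dots>, p\<^sub>m\<close> in \<open>\<epsilon>\<^sub>1\<^sup>*, \<epsilon>\<^sub>2\<^sup>*\<close> such that \<open>p\<^bsub>k-1\<^esub>\<close> and
  \<open>p\<^sub>k\<close> agree on the line through \<open>\<lambda>\<^sub>k\<close>.  The kernel of \<open>\<mu>\<close> is exactly the face ideal, because the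
  face ring has a monomial basis whose restrictions are independent, and the lattice conditions
  describe the coefficients of the piecewise linear and quadratic families.

  If \<open>l\<^sub>k\<close> is the primitive integral linear form vanishing on \<open>\<lambda>\<^sub>k\<close>, then \<open>p\<^sub>k - p\<^bsub>k-1\<^esub> = l\<^sub>k q\<^sub>k\<close>, so
  modulo the constant families a piecewise polynomial is a syzygy \<open>\<Sum>\<^sub>k l\<^sub>k q\<^sub>k = 0\<close>.  Either hypothesis
  makes the \<open>l\<^sub>k\<close> generate the module of all integral linear forms.  Hence the syzygies are generated
  by those of degree 0 and one Koszul syzygy of degree 1, which yield piecewise linear and
  quadratic families; the constant families are polynomials in two piecewise linear ones.
\<close>

section \<open>Linear extensions and the restriction map\<close>

text \<open>The obstacle is integrality. The weights have denominators \<open>D\<^sub>k\<close> and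
  a single \<open>x\<^sub>F\<close> need not lie in the ring, so every division is carried out on
  integral polynomials attached to the vertices. Agreement on the line through
  \<open>\<lambda>\<^sub>k\<close> yields divisibility over \<int> only by the form of a primitive
  vector, while \<open>\<lambda>\<^sub>k\<close> may be a proper multiple \<open>g\<^sub>k\<close>
  of one. The hypotheses speak of the \<open>\<lambda>\<^sub>k\<close> themselves; they pass to the
  \<open>l\<^sub>k\<close> because \<open>g\<^sub>k l\<^sub>k\<close> is the form attached to
  \<open>\<lambda>\<^sub>k\<close>. Two degrees of generators suffice for this reason: if
  \<open>n \<mapsto> \<Sum> n\<^sub>k l\<^sub>k\<close> maps the integral vectors onto all integral
  linear forms, then over the polynomial ring the syzygies are generated by the integral kernel of
  this map and by one lift of the Koszul relation between the two variables. The lift comes from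
  writing both variables as combinations of the \<open>l\<^sub>k\<close>. Multiplied by
  \<open>l\<^sub>k\<close> and summed, the first kind gives linear families and the second a
  quadratic one. The identification of the kernel is needed at the end, to turn equal restrictions
  into equal classes: a torsion class killed by restriction could not be reached by this
  argument.\<close>

definition lin_ext :: "('a \<Rightarrow> 'b::comm_ring_1) \<Rightarrow> ('a \<Rightarrow>\<^sub>0 int) \<Rightarrow> 'b" where
  "lin_ext \<phi> f = (\<Sum>u\<in>Poly_Mapping.keys f. of_int (Poly_Mapping.lookup f u) * \<phi> u)"

lemma lin_ext_superset:
  assumes "finite A" "Poly_Mapping.keys f \<subseteq> A"
  shows "lin_ext \<phi> f = (\<Sum>u\<in>A. of_int (Poly_Mapping.lookup f u) * \<phi> u)"
  unfolding lin_ext_def using assms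
  by (intro sum.mono_neutral_left) (auto simp: in_keys_iff)

lemma lin_ext_add: "lin_ext \<phi> (f + g) = lin_ext \<phi> f + lin_ext \<phi> g"
proof -
  let ?A = "Poly_Mapping.keys f \<union> Poly_Mapping.keys g"
  have "lin_ext \<phi> (f + g) = (\<Sum>u\<in>?A. of_int (Poly_Mapping.lookup (f + g) u) * \<phi> u)"
    by (rule lin_ext_superset[OF _ Poly_Mapping.keys_add]) simp
  then show ?thesis
    by (simp add: lin_ext_superset[of ?A f] lin_ext_superset[of ?A g] lookup_add
        distrib_right sum.distrib)
qed

lemma lin_ext_zero [simp]: "lin_ext \<phi> 0 = 0"
  by (simp add: lin_ext_def)

lemma lin_ext_uminus: "lin_ext \<phi> (- f) = - lin_ext \<phi> f"
  using lin_ext_add[of \<phi> f "- f"] by (simp add: minus_unique)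

lemma lin_ext_sum: "lin_ext \<phi> (sum f A) = (\<Sum>x\<in>A. lin_ext \<phi> (f x))"
  by (induction A rule: infinite_finite_induct) (auto simp: lin_ext_add)

lemma lin_ext_single [simp]: "lin_ext \<phi> (Poly_Mapping.single u c) = of_int c * \<phi> u"
  by (simp add: lin_ext_def)

lemma poly_mapping_eq_sum_single:
  "f = (\<Sum>u\<in>Poly_Mapping.keys f. Poly_Mapping.single u (Poly_Mapping.lookup f u))"
  by (rule poly_mapping_eqI)
    (auto simp: lookup_sum lookup_single when_def in_keys_iff sum.delta)

lemma lin_ext_mult:
  assumes "\<And>u v. \<phi> (u + v) = \<phi> u * \<phi> v"
  shows "lin_ext \<phi> (f * g) = lin_ext \<phi> f * lin_ext \<phi> g"
proof -
  let ?s = "\<lambda>f u. Poly_Mapping.single u (Poly_Mapping.lookup f u)"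
  have "f * g = (\<Sum>u\<in>Poly_Mapping.keys f. ?s f u) * (\<Sum>v\<in>Poly_Mapping.keys g. ?s g v)"
    by (simp flip: poly_mapping_eq_sum_single)
  also have "lin_ext \<phi> \<dots> = (\<Sum>u\<in>Poly_Mapping.keys f. \<Sum>v\<in>Poly_Mapping.keys g.
      (of_int (Poly_Mapping.lookup f u) * \<phi> u) * (of_int (Poly_Mapping.lookup g v) * \<phi> v))"
    by (simp only: sum_product lin_ext_sum mult_single lin_ext_single assms of_int_mult) (simp only: mult_ac)
  also have "\<dots> = lin_ext \<phi> f * lin_ext \<phi> g"
    by (simp only: sum_product lin_ext_def)
  finally show ?thesis .
qed

lemma of_int_poly_mapping: "(of_int c :: 'a::comm_monoid_add \<Rightarrow>\<^sub>0 int) = Poly_Mapping.single 0 c"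
proof -
  have "Poly_Mapping.single 0 (of_int c) = (of_int c :: 'a \<Rightarrow>\<^sub>0 int)" by (rule single_of_int)
  then show ?thesis by (simp only: of_int_eq_id id_apply)
qed

lemma lin_ext_scale: "lin_ext \<phi> (frag_cmul c f) = of_int c * lin_ext \<phi> f"
  by (subst lin_ext_superset[OF finite_keys keys_cmul])
    (simp add: lin_ext_def sum_distrib_left mult_ac)

definition mono_eval :: "('a \<Rightarrow> 'b::comm_ring_1) \<Rightarrow> ('a \<Rightarrow>\<^sub>0 nat) \<Rightarrow> 'b" where
  "mono_eval t u = (\<Prod>F\<in>Poly_Mapping.keys u. t F ^ Poly_Mapping.lookup u F)"

lemma mono_eval_superset:
  assumes "finite A" "Poly_Mapping.keys u \<subseteq> A"
  shows "mono_eval t u = (\<Prod>F\<in>A. t F ^ Poly_Mapping.lookup u F)"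
  unfolding mono_eval_def using assms
  by (intro prod.mono_neutral_left) (auto simp: in_keys_iff)

lemma mono_eval_add: "mono_eval t (u + v) = mono_eval t u * mono_eval t v"
proof -
  let ?A = "Poly_Mapping.keys u \<union> Poly_Mapping.keys v"
  have "mono_eval t (u + v) = (\<Prod>F\<in>?A. t F ^ Poly_Mapping.lookup (u + v) F)"
    by (rule mono_eval_superset[OF _ Poly_Mapping.keys_add]) simp
  then show ?thesis
    by (simp add: mono_eval_superset[of ?A u] mono_eval_superset[of ?A v] lookup_add
        power_add prod.distrib)
qed

lemma mono_eval_single [simp]: "mono_eval t (Poly_Mapping.single F n) = t F ^ n"
  by (simp add: mono_eval_def)

lemma mu_lin_ext: "mu m lam f v = lin_ext (mono_eval (\<lambda>F. tau m lam F v)) f"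
  by (simp add: mu_def lin_ext_def mono_eval_def)

lemma mu_add [simp]: "mu m lam (f + g) v = mu m lam f v + mu m lam g v"
  and mu_uminus [simp]: "mu m lam (- f) v = - mu m lam f v"
  and mu_mult [simp]: "mu m lam (f * g) v = mu m lam f v * mu m lam g v"
  and mu_zero [simp]: "mu m lam 0 v = 0"
  and mu_sum [simp]: "mu m lam (sum h A) v = (\<Sum>x\<in>A. mu m lam (h x) v)"
  by (simp_all add: mu_lin_ext lin_ext_add lin_ext_uminus lin_ext_mult mono_eval_add lin_ext_sum)

lemma mu_diff [simp]: "mu m lam (f - g) v = mu m lam f v - mu m lam g v"
  using mu_add[of m lam f "- g" v] by simp

lemma mu_of_int [simp]: "mu m lam (of_int c) v = of_int c"
  by (simp add: mu_lin_ext of_int_poly_mapping mono_eval_def)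

lemma mu_one [simp]: "mu m lam 1 v = 1"
  using mu_of_int[of m lam 1 v] by simp

lemma mu_power [simp]: "mu m lam (f ^ n) v = mu m lam f v ^ n"
  by (induction n) simp_all

lemma zconst_eq_of_int: "zconst c = of_int c"
  by (simp add: zconst_def of_int_poly_mapping)

lemma mu_xg: "F \<noteq> Whole \<Longrightarrow> mu m lam (xg F) v = tau m lam F v"
  by (simp add: xg_def mu_lin_ext)

section \<open>Integral polynomials in the variables of the proper faces\<close>

abbreviation PP :: "nat \<Rightarrow> zpoly set" where "PP m \<equiv> carrier (face_poly_ring m)"

lemma PP_def: "PP m = {f. \<forall>u \<in> Poly_Mapping.keys f. Poly_Mapping.keys u \<subseteq> faces m - {Whole}}"
  by (simp add: face_poly_ring_def)

lemma PP_add: "f \<in> PP m \<Longrightarrow> g \<in> PP m \<Longrightarrow> f + g \<in> PP m"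
  using Poly_Mapping.keys_add[of f g] by (auto simp: PP_def)

lemma PP_uminus: "f \<in> PP m \<Longrightarrow> - f \<in> PP m"
  by (simp add: PP_def)

lemma PP_diff: "f \<in> PP m \<Longrightarrow> g \<in> PP m \<Longrightarrow> f - g \<in> PP m"
  using PP_add[OF _ PP_uminus, of f m g] by simp

lemma PP_mult:
  assumes "f \<in> PP m" "g \<in> PP m" shows "f * g \<in> PP m"
  unfolding PP_def
proof (intro CollectI ballI subsetI)
  fix u F
  assume u: "u \<in> Poly_Mapping.keys (f * g)" and F: "F \<in> Poly_Mapping.keys u"
  obtain v w where vw: "u = v + w" "v \<in> Poly_Mapping.keys f" "w \<in> Poly_Mapping.keys g"
    using u Poly_Mapping.keys_mult[of f g] by blast
  then have "F \<in> Poly_Mapping.keys v \<union> Poly_Mapping.keys w"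
    using F Poly_Mapping.keys_add[of v w] by blast
  then show "F \<in> faces m - {Whole}"
    using assms vw unfolding PP_def by blast
qed

lemma PP_of_int [simp]: "of_int c \<in> PP m"
  by (simp add: PP_def of_int_poly_mapping)

lemma PP_one [simp]: "1 \<in> PP m" and PP_zero [simp]: "0 \<in> PP m"
  using PP_of_int[of 1 m] PP_of_int[of 0 m] by simp_all

lemma PP_xg: "F \<in> faces m \<Longrightarrow> xg F \<in> PP m"
  by (auto simp: PP_def xg_def)

lemma PP_sum: "(\<And>x. x \<in> A \<Longrightarrow> h x \<in> PP m) \<Longrightarrow> sum h A \<in> PP m"
  by (induction A rule: infinite_finite_induct) (auto intro: PP_add)

lemma PP_power: "f \<in> PP m \<Longrightarrow> f ^ n \<in> PP m"
  by (induction n) (auto intro: PP_mult)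

lemma face_poly_ring_simps [simp]:
  "mult (face_poly_ring m) = (*)" "one (face_poly_ring m) = 1"
  "zero (face_poly_ring m) = 0" "add (face_poly_ring m) = (+)"
  by (simp_all add: face_poly_ring_def)

lemma face_poly_ring_cring: "cring (face_poly_ring m)"
proof (rule cringI)
  show "abelian_group (face_poly_ring m)"
  proof (rule abelian_groupI)
    fix f assume f: "f \<in> PP m"
    show "\<exists>g\<in>PP m. g \<oplus>\<^bsub>face_poly_ring m\<^esub> f = \<zero>\<^bsub>face_poly_ring m\<^esub>"
      using PP_uminus[OF f] by (intro bexI[of _ "- f"]) auto
  qed (simp_all add: PP_add add_ac)
  show "Group.comm_monoid (face_poly_ring m)"
    by (rule comm_monoidI) (simp_all add: PP_mult mult_ac)
qed (simp_all add: distrib_right)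

section \<open>Faces of a polygon\<close>

lemma nxt_in: "k \<in> {1..m} \<Longrightarrow> nxt m k \<in> {1..m}"
  and prv_in: "k \<in> {1..m} \<Longrightarrow> prv m k \<in> {1..m}"
  and prv_nxt: "k \<in> {1..m} \<Longrightarrow> prv m (nxt m k) = k"
  and nxt_prv: "k \<in> {1..m} \<Longrightarrow> nxt m (prv m k) = k"
  by (auto simp: nxt_def prv_def)

lemma nxt_neq: "m \<ge> 2 \<Longrightarrow> k \<in> {1..m} \<Longrightarrow> nxt m k \<noteq> k"
  and prv_neq: "m \<ge> 2 \<Longrightarrow> k \<in> {1..m} \<Longrightarrow> prv m k \<noteq> k"
  by (auto simp: nxt_def prv_def)

lemma prv_eq_iff: "j \<in> {1..m} \<Longrightarrow> k \<in> {1..m} \<Longrightarrow> prv m j = k \<longleftrightarrow> j = nxt m k"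
  by (metis prv_nxt nxt_prv)

lemma face_cases [consumes 1, case_names Vertex Edge Whole]:
  assumes "F \<in> faces m"
  obtains k where "k \<in> {1..m}" "F = Vertex k" | k where "k \<in> {1..m}" "F = Edge k" | "F = Whole"
  using assms by (auto simp: faces_def)

lemma Vertex_in [simp]: "Vertex k \<in> faces m \<longleftrightarrow> k \<in> {1..m}"
  and Edge_in [simp]: "Edge k \<in> faces m \<longleftrightarrow> k \<in> {1..m}"
  and Whole_in [simp]: "Whole \<in> faces m"
  by (auto simp: faces_def)

text \<open>The two sides of the bigon have the same vertices, so the edge sets are needed to tell
  them apart; for \<open>m \<ge> 2\<close> the one-element vertex and edge sets also differ from
  those of \<open>Whole\<close>.\<close>

lemma face_le_antisym:
  assumes "m \<ge> 2" "E \<in> faces m" "F \<in> faces m" "face_le m E F" "face_le m F E"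
  shows "E = F"
proof -
  have *: "{k} \<noteq> {1..m}" for k
  proof
    assume "{k} = {1..m}"
    then have "1 = k" "m = k" using assms(1) by (auto simp: set_eq_iff)
    then show False using assms(1) by simp
  qed
  have **: "{1..m} \<noteq> {}" using assms(1) by auto
  have "fverts m E = fverts m F" "fedges m E = fedges m F"
    using assms(4,5) by (auto simp: face_le_def)
  with assms(2,3) * *[symmetric] ** **[symmetric] show ?thesis
    by (elim face_cases) simp_all
qed

lemma face_le_refl: "face_le m E E"
  by (simp add: face_le_def)

lemma face_le_Whole: "E \<in> faces m \<Longrightarrow> face_le m E Whole"
  by (erule face_cases) (auto simp: face_le_def nxt_def prv_def)

lemma face_join_commute: "face_join m E F = face_join m F E"
  unfolding face_join_def by (rule arg_cong[of _ _ The]) auto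

lemma face_join_le:
  assumes "m \<ge> 2" "F \<in> faces m" "face_le m E F"
  shows "face_join m E F = F"
  unfolding face_join_def
  by (rule the_equality) (use assms face_le_refl in \<open>auto intro: face_le_antisym\<close>)

lemma face_join_edges:
  assumes "m \<ge> 2" "i \<noteq> j" "i \<in> {1..m}" "j \<in> {1..m}"
  shows "face_join m (Edge i) (Edge j) = Whole"
proof -
  have *: "G = Whole" if "G \<in> faces m" "face_le m (Edge i) G" "face_le m (Edge j) G" for G
    using that assms by (auto simp: face_le_def elim: face_cases)
  show ?thesis unfolding face_join_def
    by (rule the_equality) (use * face_le_Whole assms face_le_refl in auto)
qed

lemma inter_adj_commute: "inter_adj m E F = inter_adj m F E"
  by (auto simp: inter_adj_def)

lemma components_commute: "components m E F = components m F E"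
  unfolding components_def inter_adj_commute[of m E F] by (simp add: Int_commute)

lemma fedges_fverts: "E \<in> faces m \<Longrightarrow> k \<in> fedges m E \<Longrightarrow> {prv m k, k} \<subseteq> fverts m E"
  by (erule face_cases) (auto simp: prv_def)

text \<open>Evaluates the reachability clause of \<open>components\<close> when one face contains
  the other: the intersection is then the smaller face, which is connected.\<close>

lemma face_connected:
  assumes E: "E \<in> faces m" and v: "v \<in> fverts m E"
  shows "(inter_adj m E E)\<^sup>* `` {v} = fverts m E"
proof
  show "(inter_adj m E E)\<^sup>* `` {v} \<subseteq> fverts m E"
  proof clarify
    fix u assume "(v, u) \<in> (inter_adj m E E)\<^sup>*"
    then show "u \<in> fverts m E"
    proof induction
      case (step x y)
      then obtain k where "k \<in> fedges m E" "{x, y} = {prv m k, k}" by (auto simp: inter_adj_def)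
      then show ?case using fedges_fverts[OF E] by blast
    qed (fact v)
  qed
  have sym: "sym (inter_adj m E E)" by (auto simp: sym_def inter_adj_def insert_commute)
  show "fverts m E \<subseteq> (inter_adj m E E)\<^sup>* `` {v}"
    using E
  proof (cases rule: face_cases)
    case (Edge k)
    then show ?thesis using v by (auto simp: inter_adj_def intro!: r_into_rtrancl)
  next
    case Whole
    \<comment> \<open>The path from vertex 1 upwards uses the sides 2, ..., m only, so the
      wrap-around in \<open>prv\<close> does not occur; symmetry then joins any two vertices through
      vertex 1.\<close>
    have reach: "(1, Suc k) \<in> (inter_adj m E E)\<^sup>*" if "Suc k \<le> m" for k
      using that
    proof (induction k)
      case (Suc k)
      have "(Suc k, Suc (Suc k)) \<in> inter_adj m E E"
        using Suc.prems by (auto simp: inter_adj_def Whole prv_def intro!: bexI[of _ "Suc (Suc k)"])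
      with Suc show ?case by (meson Suc_leD rtrancl.rtrancl_into_rtrancl)
    qed simp
    have "(1, u) \<in> (inter_adj m E E)\<^sup>*" if "u \<in> {1..m}" for u
      using reach[of "u - 1"] that by simp
    then have "(v, u) \<in> (inter_adj m E E)\<^sup>*" if "u \<in> {1..m}" for u
      using that v Whole symD[OF sym_rtrancl[OF sym]] by (metis fverts.simps(3) rtrancl_trans)
    then show ?thesis using Whole by auto
  qed (use v in auto)
qed

lemma components_le:
  assumes "m \<ge> 2" and E: "E \<in> faces m" and le: "face_le m E F"
  shows "components m E F = {E}"
proof -
  have i: "fverts m E \<inter> fverts m F = fverts m E" "fedges m E \<inter> fedges m F = fedges m E"
    using le by (auto simp: face_le_def)
  have adj: "inter_adj m E F = inter_adj m E E" using i by (simp add: inter_adj_def)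
  have ne: "fverts m E \<noteq> {}" using E assms(1) by (auto elim: face_cases)
  have e: "{k \<in> fedges m E. {prv m k, k} \<subseteq> fverts m E} = fedges m E"
    using fedges_fverts[OF E] by blast
  have "components m E F = {G \<in> faces m. fverts m G = fverts m E \<and> fedges m G = fedges m E}"
    unfolding components_def adj i using ne e face_connected[OF E] by auto
  also have "\<dots> = {E}"
    using E face_le_antisym[OF assms(1) _ E] by (auto simp: face_le_def)
  finally show ?thesis .
qed

lemma components_edges:
  assumes "m \<ge> 2" "i \<noteq> j" "i \<in> {1..m}" "j \<in> {1..m}"
  shows "components m (Edge i) (Edge j) = Vertex ` (fverts m (Edge i) \<inter> fverts m (Edge j))"
proof -
  have i: "fedges m (Edge i) \<inter> fedges m (Edge j) = {}" using assms by auto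
  have adj: "inter_adj m (Edge i) (Edge j) = {}" unfolding inter_adj_def i by simp
  have G: "fverts m G = {v} \<and> fedges m G = {} \<longleftrightarrow> G = Vertex v" if "G \<in> faces m" for G v
    using that assms(1) by (auto elim!: face_cases)
  have V: "Vertex v \<in> faces m" if "v \<in> fverts m (Edge i)" for v
    using that assms prv_in[of i m] by auto
  show ?thesis
    unfolding components_def adj i using G V by auto
qed

section \<open>The relations, by the relative position of two faces\<close>

lemma face_relation_le:
  assumes "m \<ge> 2" "E \<in> faces m" "F \<in> faces m" "face_le m E F"
  shows "face_relation m E F = 0" "face_relation m F E = 0"
proof -
  have "fverts m E \<inter> fverts m F \<noteq> {}"
    using assms by (auto simp: face_le_def elim!: face_cases)
  then show "face_relation m E F = 0"
    using assms by (simp add: face_relation_def face_join_le components_le)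
  then show "face_relation m F E = 0"
    by (simp add: face_relation_def face_join_commute[of m F E] components_commute[of m F E]
        Int_commute[of "fverts m F"] mult.commute split: if_splits)
qed

text \<open>The sum has two terms for the bigon, at most one for \<open>m \<ge> 3\<close>, and none
  for sides that do not meet, so this formula needs no distinction between polygons.\<close>

lemma face_relation_edges:
  assumes "m \<ge> 2" "i \<noteq> j" "i \<in> {1..m}" "j \<in> {1..m}"
  shows "face_relation m (Edge i) (Edge j) =
    xg (Edge i) * xg (Edge j) - (\<Sum>k\<in>fverts m (Edge i) \<inter> fverts m (Edge j). xg (Vertex k))"
proof (cases "fverts m (Edge i) \<inter> fverts m (Edge j) = {}")
  case False
  then show ?thesis unfolding face_relation_def
    by (simp only: face_join_edges[OF assms] components_edges[OF assms] if_False)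
       (simp add: xg_def[of Whole] sum.reindex inj_on_def mult.commute)
qed (simp add: face_relation_def mult.commute del: fverts.simps)

text \<open>A vertex is either contained in another proper face or disjoint from it, so only pairs
  of distinct edges can meet without being nested. The alternatives may overlap: two disjoint edges
  fall under the second and the third.\<close>

lemma face_relation_cases:
  assumes "m \<ge> 2" "E \<in> faces m" "F \<in> faces m"
  obtains "face_relation m E F = 0"
  | "fverts m E \<inter> fverts m F = {}" "face_relation m E F = xg E * xg F" "E \<noteq> Whole" "F \<noteq> Whole"
  | i j where "i \<in> {1..m}" "j \<in> {1..m}" "i \<noteq> j" "E = Edge i" "F = Edge j"
proof -
  consider "face_le m E F \<or> face_le m F E" | "fverts m E \<inter> fverts m F = {}"
    | i j where "i \<in> {1..m}" "j \<in> {1..m}" "i \<noteq> j" "E = Edge i" "F = Edge j"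
  proof -
    have "face_le m E F \<or> face_le m F E \<or> fverts m E \<inter> fverts m F = {} \<or>
      (\<exists>i j. i \<in> {1..m} \<and> j \<in> {1..m} \<and> i \<noteq> j \<and> E = Edge i \<and> F = Edge j)"
    proof (cases "E = Whole \<or> F = Whole")
      case True
      then show ?thesis using face_le_Whole assms by blast
    next
      case False
      then show ?thesis using assms(2,3)
        by (elim face_cases) (auto simp: face_le_def)
    qed
    then show thesis using that by blast
  qed
  then show thesis
  proof cases
    case 1
    then show ?thesis using that(1) face_relation_le assms by blast
  next
    case 2
    then have "E \<noteq> Whole" "F \<noteq> Whole"
      using assms prv_in[of _ m] by (auto elim!: face_cases)
    then show ?thesis using 2 that(2) by (simp add: face_relation_def mult.commute)
  qed (fact that(3))
qed

lemma face_relation_in: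
  assumes "m \<ge> 2" "E \<in> faces m" "F \<in> faces m"
  shows "face_relation m E F \<in> PP m"
  using assms
proof (cases rule: face_relation_cases)
  case (3 i j)
  then have "fverts m (Edge i) \<subseteq> {1..m}" using prv_in[of i m] by auto
  then show ?thesis using 3 assms
    by (auto simp: face_relation_edges intro!: PP_diff PP_mult PP_sum PP_xg)
qed (use assms in \<open>auto intro: PP_mult PP_xg\<close>)

lemma face_ideal_ideal: "m \<ge> 2 \<Longrightarrow> ideal (face_ideal m) (face_poly_ring m)"
  unfolding face_ideal_def
  by (rule ring.genideal_ideal) (auto intro: face_relation_in cring.axioms face_poly_ring_cring)

lemma face_relation_in_ideal:
  assumes "m \<ge> 2" "E \<in> faces m" "F \<in> faces m"
  shows "face_relation m E F \<in> face_ideal m"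
  unfolding face_ideal_def
  by (rule subsetD[OF ring.genideal_self])
    (use assms in \<open>auto intro: face_relation_in cring.axioms face_poly_ring_cring\<close>)

section \<open>Polynomials in two variables and the weights at a vertex\<close>

text \<open>The outer variable is \<open>\<epsilon>\<^sub>2\<^sup>*\<close>, so the arguments are the coordinates along \<open>\<epsilon>\<^sub>1\<close> and \<open>\<epsilon>\<^sub>2\<close> in this order.\<close>

definition ev :: "'a::comm_ring_1 poly poly \<Rightarrow> 'a \<Rightarrow> 'a \<Rightarrow> 'a" where
  "ev p s t = poly (poly p [:t:]) s"

lemma ev_simps [simp]:
  "ev 0 s t = 0" "ev 1 s t = 1" "ev (p + q) s t = ev p s t + ev q s t"
  "ev (p - q) s t = ev p s t - ev q s t" "ev (- p) s t = - ev p s t"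
  "ev (p * q) s t = ev p s t * ev q s t" "ev (p ^ n) s t = ev p s t ^ n"
  "ev (of_int c) s t = of_int c"
  by (simp_all add: ev_def of_int_poly)

lemma ev_sum: "ev (sum f A) s t = (\<Sum>x\<in>A. ev (f x) s t)"
  by (simp add: ev_def poly_sum)

lemma ev_pCons [simp]: "ev (pCons c p) s t = poly c s + t * ev p s t"
  by (simp add: ev_def)

lemma ev_eq_0_imp:
  fixes p :: "'a::{idom, ring_char_0} poly poly"
  assumes "\<And>s t. ev p s t = 0" shows "p = 0"
proof (rule ccontr)
  assume "p \<noteq> 0"
  have "poly p [:t:] = 0" for t
    using assms poly_all_0_iff_0[of "poly p [:t:]"] by (auto simp: ev_def)
  then have "range (\<lambda>t. [:t:]) \<subseteq> {x. poly p x = 0}" by blast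
  then have "finite (range (\<lambda>t::'a. [:t:]))"
    using poly_roots_finite[OF \<open>p \<noteq> 0\<close>] finite_subset by blast
  then have "finite (UNIV :: 'a set)"
    by (rule finite_imageD) (simp add: inj_on_def)
  then show False using infinite_UNIV_char_0 by blast
qed

section \<open>Integral polynomials inside the rational ones\<close>

definition E1 :: "int poly poly" where "E1 = [:[:0, 1:]:]"
definition E2 :: "int poly poly" where "E2 = [:0, 1:]"

lemma ev_E1 [simp]: "ev E1 s t = s" and ev_E2 [simp]: "ev E2 s t = t"
  by (simp_all add: E1_def E2_def)

lemma ev_eps1 [simp]: "ev eps1 s t = s" and ev_eps2 [simp]: "ev eps2 s t = t"
  by (simp_all add: eps1_def eps2_def)

text \<open>The coefficient inclusion. Its image is \<open>HBT\<close>, so integrality of a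
  restriction becomes the existence of a preimage, and the later algebra can be done over
  \<int>.\<close>

definition iota :: "int poly poly \<Rightarrow> rat poly poly" where
  "iota = map_poly (map_poly of_int)"

lemma map_poly_hom:
  assumes "h 0 = 0" "\<And>x y. h (x + y) = h x + h y" "\<And>x y. h (x * y) = h x * h y"
  shows "map_poly h (p + q) = map_poly h p + map_poly h q"
    and "map_poly h (p * q) = map_poly h p * map_poly h q"
proof -
  have s: "h (sum f A) = (\<Sum>x\<in>A. h (f x))" for f :: "nat \<Rightarrow> _" and A
    by (induction A rule: infinite_finite_induct) (auto simp: assms)
  show "map_poly h (p + q) = map_poly h p + map_poly h q"
    by (rule poly_eqI) (simp add: coeff_map_poly assms)
  show "map_poly h (p * q) = map_poly h p * map_poly h q"
    by (rule poly_eqI) (simp add: coeff_map_poly coeff_mult s assms)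
qed

lemma iota_add [simp]: "iota (p + q) = iota p + iota q"
  and iota_mult [simp]: "iota (p * q) = iota p * iota q"
  unfolding iota_def by (simp_all add: map_poly_hom)

lemma iota_0 [simp]: "iota 0 = 0" and iota_1 [simp]: "iota 1 = 1"
  by (simp_all add: iota_def map_poly_1')

lemma iota_uminus [simp]: "iota (- p) = - iota p"
  using iota_add[of p "- p"] by (simp add: minus_unique)

lemma iota_of_int [simp]: "iota (of_int c) = of_int c"
  by (simp add: iota_def of_int_poly map_poly_pCons)

lemma iota_E1 [simp]: "iota E1 = eps1" and iota_E2 [simp]: "iota E2 = eps2"
  by (simp_all add: iota_def E1_def E2_def eps1_def eps2_def map_poly_pCons map_poly_1')

lemma iota_power [simp]: "iota (p ^ n) = iota p ^ n"
  by (induction n) simp_all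

text \<open>The two variables and the integers generate the ring. This suits any property that is
  stable under sums and products, without an argument on degrees.\<close>

lemma int_poly_poly_induct [case_names add mult E1 E2 of_int]:
  assumes "\<And>p q. P p \<Longrightarrow> P q \<Longrightarrow> P (p + q)" "\<And>p q. P p \<Longrightarrow> P q \<Longrightarrow> P (p * q)"
    "P E1" "P E2" "\<And>c. P (of_int c)"
  shows "P p"
proof -
  have c: "P [:q:]" for q
  proof (induction q)
    case 0
    then show ?case using assms(5)[of 0] by simp
  next
    case (pCons a q)
    have "[:pCons a q:] = of_int a + E1 * [:q:]"
      by (simp add: E1_def of_int_poly)
    then show ?case using assms(1,2,3,5) pCons by metis
  qed
  show ?thesis
  proof (induction p)
    case 0
    then show ?case using assms(5)[of 0] by simp
  next
    case (pCons a q)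
    have "pCons a q = [:a:] + E2 * q" by (simp add: E2_def)
    then show ?case using assms(1,2,4) c pCons by metis
  qed
qed

lemma ev_iota: "ev (iota p) (of_int s) (of_int t) = of_int (ev p s t)"
  by (induction p rule: int_poly_poly_induct) auto

lemma HBT_eq_range_iota: "HBT = range iota"
proof
  show "range iota \<subseteq> HBT" by (auto simp: HBT_def iota_def coeff_map_poly)
  show "HBT \<subseteq> range iota"
  proof
    fix p assume p: "p \<in> HBT"
    have "of_int \<lfloor>coeff (coeff p i) j\<rfloor> = coeff (coeff p i) j" for i j
      using p Ints_cases by (fastforce simp: HBT_def)
    then have "p = iota (map_poly (map_poly floor) p)"
      by (intro poly_eqI) (simp add: iota_def coeff_map_poly del: of_int_floor_cancel)
    then show "p \<in> range iota" by blast
  qed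
qed

text \<open>The two weights at \<open>v\<^sub>k\<close>; they form the basis dual to \<open>\<lambda>\<^sub>k, \<lambda>\<^bsub>k+1\<^esub>\<close>.\<close>

definition yv :: "nat \<Rightarrow> (nat \<Rightarrow> int \<times> int) \<Rightarrow> nat \<Rightarrow> rat poly poly" where
  "yv m lam k = axial m lam (Fwd (nxt m k))"
definition zv :: "nat \<Rightarrow> (nat \<Rightarrow> int \<times> int) \<Rightarrow> nat \<Rightarrow> rat poly poly" where
  "zv m lam k = axial m lam (Rev k)"

lemma DD_nonzero:
  assumes "characteristic_function m lam" "k \<in> {1..m}"
  shows "DD m lam k \<noteq> 0"
proof
  let ?a = "ca lam k" and ?b = "cb lam k" and ?c = "ca lam (nxt m k)" and ?d = "cb lam (nxt m k)"
  assume D: "DD m lam k = 0"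
  have ne: "lam k \<noteq> 0" and ind: "\<And>p q. zscale p (lam k) + zscale q (lam (nxt m k)) = 0 \<Longrightarrow> p = 0 \<and> q = 0"
    using assms unfolding characteristic_function_def by blast+
  have "?d = 0 \<and> - ?b = 0"
    by (rule ind) (use D in \<open>simp add: zscale_def zero_prod_def DD_def ca_def cb_def algebra_simps\<close>)
  moreover have "?c = 0 \<and> - ?a = 0"
    by (rule ind) (use D in \<open>simp add: zscale_def zero_prod_def DD_def ca_def cb_def algebra_simps\<close>)
  ultimately show False using ne by (simp add: ca_def cb_def prod_eq_iff)
qed

lemma yv_eq:
  assumes "k \<in> {1..m}"
  shows "yv m lam k = [:[:0, of_int (cb lam (nxt m k)) / of_int (DD m lam k):],
    [:- of_int (ca lam (nxt m k)) / of_int (DD m lam k):]:]"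
  using assms by (simp add: yv_def prv_nxt lin_form_def eps1_def eps2_def)

lemma zv_eq:
  "zv m lam k = [:[:0, - of_int (cb lam k) / of_int (DD m lam k):],
    [:of_int (ca lam k) / of_int (DD m lam k):]:]"
  by (simp add: zv_def lin_form_def eps1_def eps2_def)

lemma of_int_poly_poly: "(of_int c :: 'a::comm_ring_1 poly poly) = [:[:of_int c:]:]"
  by (simp add: of_int_poly)

text \<open>Expansion in the dual basis: the coefficients of a linear form with respect to the two
  weights are its values on the two characteristic vectors. Substituting this into a form of degree
  \<open>n\<close> produces the matrix \<open>Phi n (Lam m lam k)\<close>, which is how the lattices
  arise.\<close>

lemma eps_eq:
  assumes "characteristic_function m lam" "k \<in> {1..m}"
  shows "eps1 = of_int (ca lam k) * yv m lam k + of_int (ca lam (nxt m k)) * zv m lam k"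
    and "eps2 = of_int (cb lam k) * yv m lam k + of_int (cb lam (nxt m k)) * zv m lam k"
proof -
  have D: "rat_of_int (DD m lam k) \<noteq> 0" using DD_nonzero[OF assms] by simp
  have D': "rat_of_int (DD m lam k) = of_int (ca lam k) * of_int (cb lam (nxt m k))
     - of_int (cb lam k) * of_int (ca lam (nxt m k))" by (simp add: DD_def)
  show "eps1 = of_int (ca lam k) * yv m lam k + of_int (ca lam (nxt m k)) * zv m lam k"
    using D unfolding yv_eq[OF assms(2)] zv_eq of_int_poly_poly eps1_def
    by (simp add: field_simps) (use D in \<open>simp add: D' algebra_simps\<close>)
  show "eps2 = of_int (cb lam k) * yv m lam k + of_int (cb lam (nxt m k)) * zv m lam k"
    using D unfolding yv_eq[OF assms(2)] zv_eq of_int_poly_poly eps2_def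
    by (simp add: field_simps) (use D in \<open>simp add: D' algebra_simps\<close>)
qed

lemma ev_yv_zv:
  assumes "characteristic_function m lam" "k \<in> {1..m}"
    and "x = of_int (ca lam k) * s + of_int (ca lam (nxt m k)) * t"
    and "y = of_int (cb lam k) * s + of_int (cb lam (nxt m k)) * t"
  shows "ev (yv m lam k) x y = s" "ev (zv m lam k) x y = t"
proof -
  have D: "rat_of_int (DD m lam k) \<noteq> 0" using DD_nonzero[OF assms(1,2)] by simp
  have D': "rat_of_int (DD m lam k) = of_int (ca lam k) * of_int (cb lam (nxt m k))
     - of_int (cb lam k) * of_int (ca lam (nxt m k))" by (simp add: DD_def)
  show "ev (yv m lam k) x y = s" "ev (zv m lam k) x y = t"
    using D unfolding yv_eq[OF assms(2)] zv_eq assms(3,4)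
    by (simp_all add: field_simps) (use D in \<open>simp_all add: D' algebra_simps\<close>)
qed

lemma oedges_at:
  assumes "k \<in> {1..m}"
  shows "{e \<in> oedges m. init_vertex m e = k \<and> side e \<notin> A} = {e \<in> {Fwd (nxt m k), Rev k}. side e \<notin> A}"
proof -
  have "e \<in> oedges m \<and> init_vertex m e = k \<longleftrightarrow> e \<in> {Fwd (nxt m k), Rev k}" for e
    using assms nxt_in[OF assms] prv_nxt[OF assms] nxt_prv[of _ m]
    by (cases e) (auto simp: oedges_def)
  then show ?thesis by blast
qed

lemma tau_Vertex:
  assumes "k \<in> {1..m}"
  shows "tau m lam (Vertex i) k = (if i = k then yv m lam k * zv m lam k else 0)"
proof -
  have "{e \<in> {Fwd (nxt m k), Rev k}. side e \<notin> {}} = {Fwd (nxt m k), Rev k}" by auto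
  then show ?thesis unfolding tau_def oedges_at[OF assms] by (simp add: yv_def zv_def)
qed

text \<open>The edge that leaves the vertex outside \<open>Edge i\<close> is the other side there,
  so a side restricts to the weight that is 1 on its own characteristic vector and 0 on that of the
  other side.\<close>

lemma tau_Edge:
  assumes "m \<ge> 2" "k \<in> {1..m}" "i \<in> {1..m}"
  shows "tau m lam (Edge i) k =
    (if i = k then yv m lam k else if i = nxt m k then zv m lam k else 0)"
proof -
  have "{e \<in> {Fwd (nxt m k), Rev k}. side e \<notin> {k}} = {Fwd (nxt m k)}"
    "{e \<in> {Fwd (nxt m k), Rev k}. side e \<notin> {nxt m k}} = {Rev k}"
    using nxt_neq[OF assms(1,2)] by auto
  moreover have "k \<in> fverts m (Edge i) \<longleftrightarrow> i = k \<or> i = nxt m k"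
    using prv_eq_iff[OF assms(3,2)] by auto
  ultimately show ?thesis unfolding tau_def oedges_at[OF assms(2)]
    by (cases "i = k"; cases "i = nxt m k") (simp_all add: yv_def zv_def del: fverts.simps init_vertex.simps axial.simps)
qed

lemma tau_disjoint: "v \<in> fverts m E \<Longrightarrow> fverts m E \<inter> fverts m F = {} \<Longrightarrow> tau m lam F v = 0"
  by (auto simp: tau_def)

lemma mu_face_relation:
  assumes "m \<ge> 2" "E \<in> faces m" "F \<in> faces m" "v \<in> {1..m}"
  shows "mu m lam (face_relation m E F) v = 0"
  using assms(1-3)
proof (cases rule: face_relation_cases)
  case 2
  then show ?thesis
    by (cases "v \<in> fverts m E") (auto simp: mu_xg tau_disjoint, simp add: tau_def)
next
  case (3 i j)
  let ?A = "fverts m (Edge i) \<inter> fverts m (Edge j)"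
  have "finite ?A" by simp
  then have "(\<Sum>k\<in>?A. mu m lam (xg (Vertex k)) v) =
      (if v \<in> ?A then yv m lam v * zv m lam v else 0)"
    by (simp add: mu_xg tau_Vertex[OF assms(4)] del: fverts.simps)
  moreover have "v \<in> ?A \<longleftrightarrow> (v = i \<or> i = nxt m v) \<and> (v = j \<or> j = nxt m v)"
    using 3 assms prv_eq_iff[of i m v] prv_eq_iff[of j m v] by auto
  ultimately show ?thesis
    using 3 assms nxt_neq[of m v]
    by (simp add: face_relation_edges mu_xg tau_Edge mult.commute del: fverts.simps)
qed simp

lemma mu_kernel_ideal: "ideal {f \<in> PP m. \<forall>v\<in>{1..m}. mu m lam f v = 0} (face_poly_ring m)"
proof -
  interpret cring "face_poly_ring m" by (rule face_poly_ring_cring)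
  show ?thesis
  proof (rule idealI)
    show "subgroup {f \<in> PP m. \<forall>v\<in>{1..m}. mu m lam f v = 0} (add_monoid (face_poly_ring m))"
    proof
      fix f assume f: "f \<in> {f \<in> PP m. \<forall>v\<in>{1..m}. mu m lam f v = 0}"
      have "inv\<^bsub>add_monoid (face_poly_ring m)\<^esub> f = - f"
        using f minus_equality[of "- f" f] by (simp add: a_inv_def PP_uminus)
      then show "inv\<^bsub>add_monoid (face_poly_ring m)\<^esub> f \<in> {f \<in> PP m. \<forall>v\<in>{1..m}. mu m lam f v = 0}"
        using f by (simp add: PP_uminus)
    qed (simp_all add: PP_add subset_iff)
  qed (simp_all add: ring_axioms PP_mult)
qed

lemma face_ideal_subset_kernel:
  assumes "m \<ge> 2"
  shows "face_ideal m \<subseteq> {f \<in> PP m. \<forall>v\<in>{1..m}. mu m lam f v = 0}"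
  unfolding face_ideal_def
  by (rule ring.genideal_minimal[OF cring.axioms(1)[OF face_poly_ring_cring] mu_kernel_ideal])
    (use assms face_relation_in mu_face_relation in blast)

section \<open>The face ideal as the kernel of restriction\<close>

lemma face_ideal_add: "m \<ge> 2 \<Longrightarrow> f \<in> face_ideal m \<Longrightarrow> g \<in> face_ideal m \<Longrightarrow> f + g \<in> face_ideal m"
  using additive_subgroup.a_closed[OF ideal.axioms(1)[OF face_ideal_ideal]] by simp

lemma face_ideal_mult: "m \<ge> 2 \<Longrightarrow> f \<in> PP m \<Longrightarrow> g \<in> face_ideal m \<Longrightarrow> f * g \<in> face_ideal m"
  using ideal.I_l_closed[OF face_ideal_ideal] by simp

lemma face_ideal_zero: "m \<ge> 2 \<Longrightarrow> 0 \<in> face_ideal m"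
  using additive_subgroup.zero_closed[OF ideal.axioms(1)[OF face_ideal_ideal]] by simp

lemma face_ideal_uminus: "m \<ge> 2 \<Longrightarrow> f \<in> face_ideal m \<Longrightarrow> - f \<in> face_ideal m"
  using face_ideal_mult[of m "- 1" f] PP_uminus[OF PP_one] by simp

lemma face_ideal_sum: "m \<ge> 2 \<Longrightarrow> (\<And>x. x \<in> A \<Longrightarrow> h x \<in> face_ideal m) \<Longrightarrow> sum h A \<in> face_ideal m"
  by (induction A rule: infinite_finite_induct) (auto intro: face_ideal_add face_ideal_zero)

text \<open>
  A monomial basis of the face ring, uniform in \<open>m \<ge> 2\<close>.  The exponents are shifted by one:
  \<open>EdgePow k i\<close> restricts to \<open>y\<^bsup>i+1\<^esup>\<close> and \<open>VertexMono k i j\<close> to \<open>y\<^bsup>i+1\<^esup> z\<^bsup>j+1\<^esup>\<close> at \<open>v\<^sub>k\<close>, where \<open>y, z\<close> are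
  the weights there.  Vertex variables absorb the products of the two edge variables, since
  \<open>x\<^bsub>v\<^esub> x\<^bsub>F\<^esub> x\<^bsub>F'\<^esub> = x\<^bsub>v\<^esub>\<^sup>2\<close> also holds for the bigon.
\<close>

datatype basis = One | EdgePow nat nat | VertexMono nat nat nat

fun bpoly :: "nat \<Rightarrow> basis \<Rightarrow> zpoly" where
  "bpoly m One = 1"
| "bpoly m (EdgePow k i) = xg (Edge k) ^ Suc i"
| "bpoly m (VertexMono k i j) =
     xg (Vertex k) ^ Suc (min i j) * xg (Edge k) ^ (i - j) * xg (Edge (nxt m k)) ^ (j - i)"

fun valid :: "nat \<Rightarrow> basis \<Rightarrow> bool" where
  "valid m One = True"
| "valid m (EdgePow k i) \<longleftrightarrow> k \<in> {1..m}"
| "valid m (VertexMono k i j) \<longleftrightarrow> k \<in> {1..m}"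

text \<open>The combination \<open>c\<close> is kept formal, so that its coefficients can later be
  recovered from its restrictions.\<close>

definition spanned :: "nat \<Rightarrow> zpoly \<Rightarrow> bool" where
  "spanned m f \<longleftrightarrow> (\<exists>c. (\<forall>b\<in>Poly_Mapping.keys c. valid m b) \<and> f - lin_ext (bpoly m) c \<in> face_ideal m)"

lemma spanned_cong:
  assumes "m \<ge> 2" "f - g \<in> face_ideal m" "spanned m g"
  shows "spanned m f"
proof -
  obtain c where c: "\<forall>b\<in>Poly_Mapping.keys c. valid m b" "g - lin_ext (bpoly m) c \<in> face_ideal m"
    using assms(3) unfolding spanned_def by blast
  have "f - lin_ext (bpoly m) c \<in> face_ideal m"
    using face_ideal_add[OF assms(1,2) c(2)] by simp
  with c(1) show ?thesis unfolding spanned_def by blast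
qed

lemma spanned_basis: "m \<ge> 2 \<Longrightarrow> valid m b \<Longrightarrow> spanned m (bpoly m b)"
  unfolding spanned_def
  by (rule exI[of _ "Poly_Mapping.single b 1"]) (simp add: face_ideal_zero)

lemma spanned_zero: "m \<ge> 2 \<Longrightarrow> f \<in> face_ideal m \<Longrightarrow> spanned m f"
  unfolding spanned_def by (rule exI[of _ 0]) simp

lemma spanned_add:
  assumes "m \<ge> 2" "spanned m f" "spanned m g"
  shows "spanned m (f + g)"
proof -
  obtain c d where c: "\<forall>b\<in>Poly_Mapping.keys c. valid m b" "f - lin_ext (bpoly m) c \<in> face_ideal m"
    and d: "\<forall>b\<in>Poly_Mapping.keys d. valid m b" "g - lin_ext (bpoly m) d \<in> face_ideal m"
    using assms unfolding spanned_def by blast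
  have "f + g - lin_ext (bpoly m) (c + d) \<in> face_ideal m"
    using face_ideal_add[OF assms(1) c(2) d(2)] by (simp add: lin_ext_add algebra_simps)
  moreover have "\<forall>b\<in>Poly_Mapping.keys (c + d). valid m b"
    using c(1) d(1) Poly_Mapping.keys_add[of c d] by blast
  ultimately show ?thesis unfolding spanned_def by blast
qed

lemma spanned_sum: "m \<ge> 2 \<Longrightarrow> (\<And>x. x \<in> A \<Longrightarrow> spanned m (h x)) \<Longrightarrow> spanned m (sum h A)"
  by (induction A rule: infinite_finite_induct) (auto intro: spanned_add spanned_zero face_ideal_zero)

lemma spanned_scale:
  assumes "m \<ge> 2" "spanned m f"
  shows "spanned m (of_int n * f)"
proof -
  obtain c where c: "\<forall>b\<in>Poly_Mapping.keys c. valid m b" "f - lin_ext (bpoly m) c \<in> face_ideal m"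
    using assms unfolding spanned_def by blast
  have "of_int n * f - lin_ext (bpoly m) (frag_cmul n c) \<in> face_ideal m"
    using face_ideal_mult[OF assms(1) PP_of_int[of n] c(2)] by (simp add: lin_ext_scale right_diff_distrib)
  moreover have "\<forall>b\<in>Poly_Mapping.keys (frag_cmul n c). valid m b"
    using c(1) keys_cmul[of n c] by blast
  ultimately show ?thesis unfolding spanned_def by blast
qed

lemma disjoint_faces_in_ideal:
  assumes "m \<ge> 2" "E \<in> faces m" "F \<in> faces m" "fverts m E \<inter> fverts m F = {}"
  shows "xg E * xg F \<in> face_ideal m"
  using face_relation_in_ideal[OF assms(1-3)] assms(4)
  by (simp add: face_relation_def mult.commute)

lemma vertex_vertex_in_ideal:
  "m \<ge> 2 \<Longrightarrow> k \<in> {1..m} \<Longrightarrow> i \<in> {1..m} \<Longrightarrow> i \<noteq> k \<Longrightarrow> xg (Vertex k) * xg (Vertex i) \<in> face_ideal m"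
  by (rule disjoint_faces_in_ideal) auto

lemma vertex_edge_in_ideal:
  "m \<ge> 2 \<Longrightarrow> k \<in> {1..m} \<Longrightarrow> i \<in> {1..m} \<Longrightarrow> i \<noteq> k \<Longrightarrow> i \<noteq> nxt m k \<Longrightarrow>
    xg (Vertex k) * xg (Edge i) \<in> face_ideal m"
  by (rule disjoint_faces_in_ideal) (auto simp: prv_eq_iff dest: sym)

text \<open>Multiplying the relation of the two sides by the variable of the vertex kills the
  summand of every other common vertex; only the bigon has one.\<close>

lemma vertex_edge_edge_in_ideal:
  assumes "m \<ge> 2" "k \<in> {1..m}"
  shows "xg (Vertex k) * (xg (Edge k) * xg (Edge (nxt m k))) - xg (Vertex k) ^ 2 \<in> face_ideal m"
proof -
  let ?A = "fverts m (Edge k) \<inter> fverts m (Edge (nxt m k))"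
  have k: "k \<in> ?A" using assms by (simp add: prv_nxt)
  have A: "?A \<subseteq> {1..m}" using assms nxt_in[OF assms(2)] prv_in by auto
  have fin: "finite ?A" by simp
  have "xg (Vertex k) * face_relation m (Edge k) (Edge (nxt m k)) \<in> face_ideal m"
    using assms nxt_in[OF assms(2)]
    by (intro face_ideal_mult face_relation_in_ideal PP_xg) auto
  moreover have "face_relation m (Edge k) (Edge (nxt m k)) =
      xg (Edge k) * xg (Edge (nxt m k)) - (\<Sum>i\<in>?A. xg (Vertex i))"
    using assms nxt_neq[OF assms] nxt_in[OF assms(2)] by (intro face_relation_edges) auto
  ultimately have 1: "xg (Vertex k) * (xg (Edge k) * xg (Edge (nxt m k)))
      - (\<Sum>i\<in>?A. xg (Vertex k) * xg (Vertex i)) \<in> face_ideal m"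
    by (simp only: right_diff_distrib sum_distrib_left)
  have 2: "(\<Sum>i\<in>?A - {k}. xg (Vertex k) * xg (Vertex i)) \<in> face_ideal m"
    using A assms by (intro face_ideal_sum vertex_vertex_in_ideal) auto
  show ?thesis
    using face_ideal_add[OF assms(1) 1 2]
    by (simp add: sum.remove[OF fin k] power2_eq_square del: fverts.simps)
qed

text \<open>Next to a vertex variable, powers of the two adjacent sides and of the vertex itself
  give basis elements again, and everything else is disjoint from the vertex.\<close>

lemma spanned_vertex_basis:
  assumes m: "m \<ge> 2" and k: "k \<in> {1..m}" and b: "valid m b"
  shows "spanned m (xg (Vertex k) * bpoly m b)"
proof (cases b)
  case One
  then show ?thesis using spanned_basis[OF m, of "VertexMono k 0 0"] k by simp
next
  case (EdgePow i n)
  consider "i = k" | "i = nxt m k" | "i \<noteq> k" "i \<noteq> nxt m k" by blast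
  then show ?thesis
  proof cases
    case 1
    then show ?thesis using EdgePow spanned_basis[OF m, of "VertexMono k (Suc n) 0"] k by simp
  next
    case 2
    then show ?thesis using EdgePow spanned_basis[OF m, of "VertexMono k 0 (Suc n)"] k by simp
  next
    case 3
    have "xg (Edge i) ^ n * (xg (Vertex k) * xg (Edge i)) \<in> face_ideal m"
      using 3 EdgePow b k m by (intro face_ideal_mult vertex_edge_in_ideal PP_power PP_xg) auto
    then show ?thesis using EdgePow by (intro spanned_zero m) (simp add: mult_ac)
  qed
next
  case (VertexMono i p q)
  show ?thesis
  proof (cases "i = k")
    case True
    then show ?thesis
      using VertexMono spanned_basis[OF m, of "VertexMono k (Suc p) (Suc q)"] k by (simp add: mult_ac)
  next
    case False
    have "(xg (Vertex i) ^ min p q * xg (Edge i) ^ (p - q) * xg (Edge (nxt m i)) ^ (q - p))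
        * (xg (Vertex k) * xg (Vertex i)) \<in> face_ideal m"
      using False VertexMono b k m nxt_in[of i m]
      by (intro face_ideal_mult vertex_vertex_in_ideal PP_mult PP_power PP_xg) auto
    then show ?thesis using VertexMono by (intro spanned_zero m) (simp add: mult_ac)
  qed
qed

text \<open>The product of two different sides is replaced by a sum of vertex variables, which leads
  back to \<open>spanned_vertex_basis\<close>. A \<open>VertexMono\<close> carries at most one of
  its two sides, so the other one, when it is multiplied in, is absorbed into the vertex
  variable.\<close>

lemma spanned_edge_basis:
  assumes m: "m \<ge> 2" and e: "e \<in> {1..m}" and b: "valid m b"
  shows "spanned m (xg (Edge e) * bpoly m b)"
proof (cases b)
  case One
  then show ?thesis using spanned_basis[OF m, of "EdgePow e 0"] e by simp
next
  case (EdgePow i n)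
  have i: "i \<in> {1..m}" using EdgePow b by simp
  show ?thesis
  proof (cases "i = e")
    case True
    then show ?thesis using EdgePow spanned_basis[OF m, of "EdgePow e (Suc n)"] e by simp
  next
    case False
    let ?A = "fverts m (Edge e) \<inter> fverts m (Edge i)"
    have A: "?A \<subseteq> {1..m}" using i prv_in by auto
    have n: "spanned m (xg (Vertex k) * xg (Edge i) ^ n)" if "k \<in> {1..m}" for k
      using spanned_vertex_basis[OF m that, of One] spanned_vertex_basis[OF m that, of "EdgePow i (n - 1)"] i
      by (cases n) simp_all
    have "xg (Edge i) ^ n * face_relation m (Edge e) (Edge i) \<in> face_ideal m"
      using i e m by (intro face_ideal_mult face_relation_in_ideal PP_power PP_xg) auto
    then have "xg (Edge e) * bpoly m b - (\<Sum>k\<in>?A. xg (Vertex k) * xg (Edge i) ^ n) \<in> face_ideal m"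
      using EdgePow face_relation_edges[OF m _ e i] False
      by (simp add: right_diff_distrib sum_distrib_left mult_ac del: fverts.simps)
    moreover have "spanned m (\<Sum>k\<in>?A. xg (Vertex k) * xg (Edge i) ^ n)"
      using A n by (intro spanned_sum m) blast
    ultimately show ?thesis by (rule spanned_cong[OF m])
  qed
next
  case (VertexMono k p q)
  let ?v = "xg (Vertex k)" and ?e = "xg (Edge k)" and ?f = "xg (Edge (nxt m k))"
  have k: "k \<in> {1..m}" and k': "nxt m k \<in> {1..m}" using VertexMono b nxt_in by simp_all
  have v: "?v \<in> PP m" "?e \<in> PP m" "?f \<in> PP m" using k k' by (auto intro: PP_xg)
  note vef = vertex_edge_edge_in_ideal[OF m k]
  consider "e = k" "q \<le> p" | "e = k" "p < q" | "e = nxt m k" "p \<le> q" | "e = nxt m k" "q < p"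
    | "e \<noteq> k" "e \<noteq> nxt m k" by linarith
  then show ?thesis
  proof cases
    case 1
    then obtain d where d: "p = q + d" using le_Suc_ex by blast
    have "min (Suc (q + d)) q = q" "min (q + d) q = q" by simp_all
    then show ?thesis using 1 d VertexMono spanned_basis[OF m, of "VertexMono k (Suc p) q"] k
      by (simp add: mult_ac)
  next
    case 2
    obtain d where d: "q = p + Suc d" using 2 less_iff_Suc_add by auto
    \<comment> \<open>Since \<open>p < q\<close>, a factor \<open>?f\<close> is left over; together
      with the new \<open>?e\<close> it becomes a further \<open>?v\<close>, which raises
      \<open>p\<close> by one.\<close>
    have "(?v ^ p * ?f ^ d) * (?v * (?e * ?f) - ?v ^ 2) \<in> face_ideal m"
      using v by (intro face_ideal_mult m vef PP_mult PP_power)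
    then have "xg (Edge e) * bpoly m b - bpoly m (VertexMono k (Suc p) q) \<in> face_ideal m"
      using 2 VertexMono d by (simp add: algebra_simps power2_eq_square)
    then show ?thesis by (rule spanned_cong[OF m]) (use k in \<open>simp add: spanned_basis m del: bpoly.simps\<close>)
  next
    case 3
    then obtain d where d: "q = p + d" using le_Suc_ex by blast
    have "min p (Suc (p + d)) = p" "min p (p + d) = p" by simp_all
    then show ?thesis using 3 d VertexMono spanned_basis[OF m, of "VertexMono k p (Suc q)"] k
      by (simp add: mult_ac)
  next
    case 4
    obtain d where d: "p = q + Suc d" using 4 less_iff_Suc_add by auto
    have "(?v ^ q * ?e ^ d) * (?v * (?e * ?f) - ?v ^ 2) \<in> face_ideal m"
      using v by (intro face_ideal_mult m vef PP_mult PP_power)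
    then have "xg (Edge e) * bpoly m b - bpoly m (VertexMono k p (Suc q)) \<in> face_ideal m"
      using 4 VertexMono d by (simp add: algebra_simps power2_eq_square)
    then show ?thesis by (rule spanned_cong[OF m]) (use k in \<open>simp add: spanned_basis m del: bpoly.simps\<close>)
  next
    case 5
    have "(?v ^ min p q * ?e ^ (p - q) * ?f ^ (q - p)) * (?v * xg (Edge e)) \<in> face_ideal m"
      using 5 v by (intro face_ideal_mult m vertex_edge_in_ideal PP_mult PP_power k e)
    then show ?thesis using VertexMono by (intro spanned_zero m) (simp add: mult_ac)
  qed
qed

lemma spanned_xg_mult:
  assumes m: "m \<ge> 2" and F: "F \<in> faces m" and f: "spanned m f"
  shows "spanned m (xg F * f)"
proof -
  obtain c where c: "\<forall>b\<in>Poly_Mapping.keys c. valid m b" "f - lin_ext (bpoly m) c \<in> face_ideal m"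
    using f unfolding spanned_def by blast
  have b: "spanned m (xg F * bpoly m b)" if "valid m b" for b
    using F that by (cases rule: face_cases)
      (auto intro: spanned_vertex_basis spanned_edge_basis spanned_basis m simp: xg_def[of Whole])
  have 1: "spanned m (xg F * lin_ext (bpoly m) c)"
    using c(1) b spanned_scale[OF m]
    by (auto simp: lin_ext_def sum_distrib_left mult.left_commute[of "xg F"] intro!: spanned_sum[OF m])
  have "xg F * f - xg F * lin_ext (bpoly m) c \<in> face_ideal m"
    using face_ideal_mult[OF m PP_xg[OF F] c(2)] by (simp add: right_diff_distrib)
  from spanned_cong[OF m this 1] show ?thesis .
qed

lemma spanned_xg_power_mult:
  "m \<ge> 2 \<Longrightarrow> F \<in> faces m \<Longrightarrow> spanned m f \<Longrightarrow> spanned m (xg F ^ n * f)"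
  by (induction n) (auto simp: mult.assoc intro: spanned_xg_mult)

lemma single_plus: "Poly_Mapping.single (a + b) (1::int) = Poly_Mapping.single a 1 * Poly_Mapping.single b 1"
  by (simp only: mult_single mult_1)

lemma single_single_eq_xg_power:
  assumes "F \<noteq> Whole"
  shows "Poly_Mapping.single (Poly_Mapping.single F n) 1 = xg F ^ n"
proof (induction n)
  case (Suc n)
  have "Poly_Mapping.single F (Suc n) = Poly_Mapping.single F 1 + Poly_Mapping.single F n"
    by (simp flip: single_add)
  then show ?case using Suc assms by (simp only: single_plus) (simp add: xg_def)
qed simp

text \<open>The span contains 1 and is stable under multiplication by every variable, hence contains
  all monomials.\<close>

lemma spanned_PP:
  assumes m: "m \<ge> 2" and f: "f \<in> PP m"
  shows "spanned m f"
proof -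
  have A: "spanned m (Poly_Mapping.single (\<Sum>F\<in>A. Poly_Mapping.single F (n F)) 1)"
    if "finite A" "A \<subseteq> faces m - {Whole}" for A :: "face set" and n
    using that
  proof (induction A)
    case empty
    then show ?case using spanned_basis[OF m, of One] by simp
  next
    case (insert F A)
    have "(\<Sum>F\<in>insert F A. Poly_Mapping.single F (n F)) =
        Poly_Mapping.single F (n F) + (\<Sum>F\<in>A. Poly_Mapping.single F (n F))"
      using insert by simp
    moreover have "Poly_Mapping.single (Poly_Mapping.single F (n F)) 1 = xg F ^ n F"
      using insert by (intro single_single_eq_xg_power) auto
    ultimately have "Poly_Mapping.single (\<Sum>F\<in>insert F A. Poly_Mapping.single F (n F)) (1::int) =
        xg F ^ n F * Poly_Mapping.single (\<Sum>F\<in>A. Poly_Mapping.single F (n F)) 1"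
      by (simp only: single_plus)
    then show ?case using insert spanned_xg_power_mult[OF m] by simp
  qed
  have "spanned m (of_int c * Poly_Mapping.single u 1)" if "u \<in> Poly_Mapping.keys f" for u c
  proof (rule spanned_scale[OF m])
    have "Poly_Mapping.keys u \<subseteq> faces m - {Whole}" using that f by (auto simp: PP_def)
    then show "spanned m (Poly_Mapping.single u 1)"
      using A[OF finite_keys, of u "Poly_Mapping.lookup u"] by (simp flip: poly_mapping_eq_sum_single)
  qed
  then have "spanned m (\<Sum>u\<in>Poly_Mapping.keys f. Poly_Mapping.single u (Poly_Mapping.lookup f u))"
    by (intro spanned_sum m) (metis (no_types, lifting) add_0 mult.right_neutral mult_single of_int_poly_mapping)
  then show ?thesis by (simp flip: poly_mapping_eq_sum_single)
qed

text \<open>The exponents of the two weights in the restriction of a basis element to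
  \<open>v\<^sub>k\<close>; \<open>None\<close> stands for the restriction 0.\<close>

fun expo :: "nat \<Rightarrow> nat \<Rightarrow> basis \<Rightarrow> (nat \<times> nat) option" where
  "expo m k One = Some (0, 0)"
| "expo m k (EdgePow i n) = (if i = k then Some (Suc n, 0) else if i = nxt m k then Some (0, Suc n) else None)"
| "expo m k (VertexMono i p q) = (if i = k then Some (Suc p, Suc q) else None)"

lemma mu_bpoly:
  assumes "m \<ge> 2" "k \<in> {1..m}" "valid m b"
  shows "mu m lam (bpoly m b) k =
    (case expo m k b of None \<Rightarrow> 0 | Some (i, j) \<Rightarrow> yv m lam k ^ i * zv m lam k ^ j)"
proof (cases b)
  case (VertexMono i p q)
  let ?y = "yv m lam k" and ?z = "zv m lam k"
  have "(?y * ?z) ^ Suc (min p q) * ?y ^ (p - q) * ?z ^ (q - p)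
      = ?y ^ (Suc (min p q) + (p - q)) * ?z ^ (Suc (min p q) + (q - p))"
    by (simp only: power_add power_mult_distrib mult_ac)
  moreover have "Suc (min p q) + (p - q) = Suc p" "Suc (min p q) + (q - p) = Suc q" by auto
  ultimately have e: "(?y * ?z) ^ Suc (min p q) * ?y ^ (p - q) * ?z ^ (q - p) = ?y ^ Suc p * ?z ^ Suc q"
    by simp
  show ?thesis
  proof (cases "i = k")
    case True
    then have "mu m lam (bpoly m b) k = (?y * ?z) ^ Suc (min p q) * ?y ^ (p - q) * ?z ^ (q - p)"
      using assms VertexMono nxt_neq[of m k] nxt_in[of k m]
      by (simp add: mu_xg tau_Vertex tau_Edge del: power_Suc)
    with e True VertexMono show ?thesis by simp
  qed (use assms VertexMono in \<open>simp add: mu_xg tau_Vertex\<close>)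
qed (use assms in \<open>auto simp: mu_xg tau_Edge\<close>)

lemma ev_monom: "ev (monom (monom c i) j) s t = c * (s ^ i * t ^ j)"
  by (simp add: ev_def poly_monom mult_ac)

text \<open>Every basis element has a vertex at which no other basis element has the same pair of
  exponents: any vertex for \<open>One\<close>, and \<open>v\<^sub>k\<close> for
  \<open>EdgePow k\<close> (a pure power of the first weight) and for \<open>VertexMono k\<close>.
  As the two weights are independent, its coefficient can be read off there.\<close>

lemma kernel_lin_ext_zero:
  assumes m: "m \<ge> 2" and char: "characteristic_function m lam"
    and c: "\<forall>b\<in>Poly_Mapping.keys c. valid m b"
    and mu: "\<And>k. k \<in> {1..m} \<Longrightarrow> mu m lam (lin_ext (bpoly m) c) k = 0"
  shows "c = 0"
proof (rule ccontr)
  assume "c \<noteq> 0"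
  then obtain b0 where b0: "b0 \<in> Poly_Mapping.keys c" using keys_eq_empty by blast
  obtain k i j where k: "k \<in> {1..m}" and e: "expo m k b0 = Some (i, j)"
    and u: "\<And>b. valid m b \<Longrightarrow> expo m k b = Some (i, j) \<Longrightarrow> b = b0"
  proof (cases b0)
    case One
    have "b = b0" if "expo m 1 b = Some (0, 0)" for b
      using that One by (cases b) (auto split: if_splits)
    then show thesis using that[of 1 0 0] One m by auto
  next
    case (EdgePow k n)
    have "b = b0" if "expo m k b = Some (Suc n, 0)" for b
      using that EdgePow by (cases b) (auto split: if_splits)
    then show thesis using that[of k "Suc n" 0] EdgePow b0 c by auto
  next
    case (VertexMono k p q)
    have "b = b0" if "expo m k b = Some (Suc p, Suc q)" for b
      using that VertexMono by (cases b) (auto split: if_splits)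
    then show thesis using that[of k "Suc p" "Suc q"] VertexMono b0 c by auto
  qed
  let ?Q = "\<Sum>b\<in>Poly_Mapping.keys c. (case expo m k b of None \<Rightarrow> 0
    | Some (p, q) \<Rightarrow> monom (monom (rat_of_int (Poly_Mapping.lookup c b)) p) q)"
  have "?Q = 0"
  proof (rule ev_eq_0_imp)
    fix s t :: rat
    define x where "x = of_int (ca lam k) * s + of_int (ca lam (nxt m k)) * t"
    define y where "y = of_int (cb lam k) * s + of_int (cb lam (nxt m k)) * t"
    note ev = ev_yv_zv[OF char k x_def y_def]
    have "0 = ev (mu m lam (lin_ext (bpoly m) c) k) x y" by (simp add: mu[OF k])
    also have "\<dots> = (\<Sum>b\<in>Poly_Mapping.keys c. of_int (Poly_Mapping.lookup c b) *
        (case expo m k b of None \<Rightarrow> 0 | Some (p, q) \<Rightarrow> s ^ p * t ^ q))"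
      unfolding lin_ext_def using c
      by (auto simp: ev_sum mu_bpoly[OF m k] ev intro!: sum.cong split: option.split)
    also have "\<dots> = ev ?Q s t"
      by (auto simp: ev_sum ev_monom intro!: sum.cong split: option.split)
    finally show "ev ?Q s t = 0" by simp
  qed
  then have "0 = coeff (coeff ?Q j) i" by simp
  also have "\<dots> = (\<Sum>b\<in>Poly_Mapping.keys c. if b = b0 then of_int (Poly_Mapping.lookup c b) else 0)"
    unfolding coeff_sum using u e c
    by (intro sum.cong refl) (auto split: option.split)
  also have "\<dots> = of_int (Poly_Mapping.lookup c b0)" using b0 by simp
  finally show False using b0 by (simp add: in_keys_iff)
qed

theorem face_ideal_eq_kernel:
  assumes m: "m \<ge> 2" and char: "characteristic_function m lam"
  shows "face_ideal m = {f \<in> PP m. \<forall>v\<in>{1..m}. mu m lam f v = 0}"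
proof (rule antisym[OF face_ideal_subset_kernel[OF m]], safe)
  fix f assume f: "f \<in> PP m" "\<forall>v\<in>{1..m}. mu m lam f v = 0"
  obtain c where c: "\<forall>b\<in>Poly_Mapping.keys c. valid m b" "f - lin_ext (bpoly m) c \<in> face_ideal m"
    using spanned_PP[OF m f(1)] unfolding spanned_def by blast
  have "mu m lam (f - lin_ext (bpoly m) c) v = 0" if "v \<in> {1..m}" for v
    using subsetD[OF face_ideal_subset_kernel[OF m] c(2)] that by blast
  then have "c = 0" using f(2) by (intro kernel_lin_ext_zero[OF m char c(1)]) simp
  then show "f \<in> face_ideal m" using c(2) by simp
qed

section \<open>Divisibility and syzygies\<close>

definition lform :: "int \<Rightarrow> int \<Rightarrow> int poly poly" where
  "lform a b = of_int b * E1 - of_int a * E2"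

lemma ev_lform [simp]: "ev (lform a b) s t = b * s - a * t"
  by (simp add: lform_def)

text \<open>
  With \<open>L = s \<epsilon>\<^sub>1\<^sup>* + t \<epsilon>\<^sub>2\<^sup>*\<close>, the variables are congruent to \<open>a L\<close> and \<open>b L\<close> modulo the linear form, so every
  polynomial is congruent to a polynomial in \<open>L\<close>, and \<open>L\<close> takes the value \<open>n\<close> at \<open>(n a, n b)\<close>.
\<close>

lemma lform_dvd:
  assumes st: "s * a + t * b = 1" and p: "\<And>n. ev p (n * a) (n * b) = 0"
  shows "lform a b dvd p"
proof -
  let ?l = "lform a b" and ?L = "of_int s * E1 + of_int t * E2"
  let ?e = "\<lambda>r. poly (map_poly of_int r) ?L"
  have e_add: "?e (r + r') = ?e r + ?e r'" and e_mult: "?e (r * r') = ?e r * ?e r'" for r r'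
    by (simp_all add: map_poly_hom)
  have e_ev: "ev (?e r) x y = poly r (ev ?L x y)" for r x y
    by (induction r) (simp_all add: map_poly_pCons)
  have st': "of_int s * of_int a + of_int t * of_int b = (1 :: int poly poly)"
    using st by (metis of_int_1 of_int_add of_int_mult)
  have E1eq: "E1 = of_int a * ?L + of_int t * ?l"
  proof -
    have "of_int a * ?L + of_int t * ?l = (of_int s * of_int a + of_int t * of_int b) * E1"
      by (simp add: lform_def algebra_simps)
    then show ?thesis by (simp add: st')
  qed
  have E2eq: "E2 = of_int b * ?L - of_int s * ?l"
  proof -
    have "of_int b * ?L - of_int s * ?l = (of_int s * of_int a + of_int t * of_int b) * E2"
      by (simp add: lform_def algebra_simps)
    then show ?thesis by (simp add: st')
  qed
  have "\<exists>q r. p = ?l * q + ?e r"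
  proof (induction p rule: int_poly_poly_induct)
    case (add p p')
    then obtain q r q' r' where "p = ?l * q + ?e r" "p' = ?l * q' + ?e r'" by blast
    then have "p + p' = ?l * (q + q') + ?e (r + r')" by (simp only: e_add) (simp add: algebra_simps)
    then show ?case by blast
  next
    case (mult p p')
    then obtain q r q' r' where "p = ?l * q + ?e r" "p' = ?l * q' + ?e r'" by blast
    then have "p * p' = ?l * (q * (?l * q' + ?e r') + ?e r * q') + ?e (r * r')"
      by (simp only: e_mult) (simp add: algebra_simps)
    then show ?case by blast
  next
    case E1
    have "E1 = ?l * of_int t + ?e [:0, a:]"
      by (rule trans[OF E1eq]) (simp add: map_poly_pCons algebra_simps)
    then show ?case by blast
  next
    case E2
    have "E2 = ?l * (- of_int s) + ?e [:0, b:]"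
      by (rule trans[OF E2eq]) (simp add: map_poly_pCons algebra_simps)
    then show ?case by blast
  next
    case (of_int c)
    have "of_int c = ?l * 0 + ?e [:c:]" by (simp add: map_poly_pCons)
    then show ?case by blast
  qed
  then obtain q r where qr: "p = ?l * q + ?e r" by blast
  have "poly r n = 0" for n
  proof -
    have "ev ?L (n * a) (n * b) = n * (s * a + t * b)" by (simp add: algebra_simps)
    then have "ev ?L (n * a) (n * b) = n" using st by simp
    then have "poly r n = ev (?e r) (n * a) (n * b)" using e_ev by simp
    also have "\<dots> = ev p (n * a) (n * b)" by (simp add: qr)
    finally show ?thesis using p by simp
  qed
  then have "r = 0" using poly_all_0_iff_0 by blast
  then show ?thesis using qr by simp
qed

text \<open>The bound is strict, so that bound 0 forces the polynomial to be 0 and an induction on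
  the bound can start there.\<close>

definition total_degree_less :: "nat \<Rightarrow> int poly poly \<Rightarrow> bool" where
  "total_degree_less N p \<longleftrightarrow> (\<forall>i j. coeff (coeff p i) j \<noteq> 0 \<longrightarrow> i + j < N)"

lemma total_degree_less_add: "total_degree_less N p \<Longrightarrow> total_degree_less N q \<Longrightarrow> total_degree_less N (p + q)"
  and total_degree_less_diff: "total_degree_less N p \<Longrightarrow> total_degree_less N q \<Longrightarrow> total_degree_less N (p - q)"
  unfolding total_degree_less_def by (metis coeff_add add.right_neutral, metis coeff_diff diff_zero right_minus_eq)

lemma total_degree_less_sum: "(\<And>x. x \<in> A \<Longrightarrow> total_degree_less N (f x)) \<Longrightarrow> total_degree_less N (sum f A)"
  by (induction A rule: infinite_finite_induct) (auto intro: total_degree_less_add simp: total_degree_less_def[of _ 0])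

lemma total_degree_less_of_int_mult: "total_degree_less N p \<Longrightarrow> total_degree_less N (of_int c * p)"
  by (auto simp: total_degree_less_def of_int_poly)

lemma coeff_E1_mult: "coeff (coeff (E1 * p) i) j = (if j = 0 then 0 else coeff (coeff p i) (j - 1))"
  by (cases j) (simp_all add: E1_def)

lemma coeff_E2_mult: "coeff (E2 * p) i = (if i = 0 then 0 else coeff p (i - 1))"
  by (cases i) (simp_all add: E2_def)

lemma total_degree_less_lform_mult: "total_degree_less N p \<Longrightarrow> total_degree_less (Suc N) (lform a b * p)"
proof -
  assume p: "total_degree_less N p"
  have "total_degree_less (Suc N) (E1 * p)" "total_degree_less (Suc N) (E2 * p)"
    using p by (fastforce simp: total_degree_less_def coeff_E1_mult coeff_E2_mult)+
  then show ?thesis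
    by (simp add: lform_def left_diff_distrib mult.assoc total_degree_less_diff total_degree_less_of_int_mult)
qed

text \<open>Every monomial containing \<open>E2\<close> goes into \<open>b\<close>; \<open>a\<close>
  keeps the pure powers of \<open>E1\<close>. No cancellation occurs, so both parts lose one
  degree.\<close>

lemma poly_decompose:
  obtains n a b where "p = of_int n + E1 * a + E2 * b" "\<And>N. total_degree_less (Suc N) p \<Longrightarrow> total_degree_less N a \<and> total_degree_less N b"
proof -
  let ?a = "[:poly_shift 1 (coeff p 0):]" and ?b = "poly_shift 1 p"
  have shift: "q = pCons (coeff q 0) (poly_shift 1 q)" for q :: "'z::comm_ring_1 poly"
    by (rule poly_eqI) (simp add: coeff_pCons coeff_poly_shift split: nat.split)
  have "p = of_int (coeff (coeff p 0) 0) + E1 * ?a + E2 * ?b"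
    by (subst shift, subst (2) shift) (simp add: E1_def E2_def of_int_poly)
  moreover have "total_degree_less N ?a \<and> total_degree_less N ?b" if "total_degree_less (Suc N) p" for N
    using that by (fastforce simp: total_degree_less_def coeff_poly_shift coeff_pCons split: nat.splits)
  ultimately show thesis using that by blast
qed

text \<open>Exactness of the Koszul complex of the two variables: modulo \<open>E2\<close> the
  relation reads \<open>E1 * A = 0\<close>, so \<open>E2\<close> divides \<open>A\<close>, and
  cancelling \<open>E2\<close> determines \<open>B\<close>.\<close>

lemma syzygy_E1_E2:
  assumes "E1 * A + E2 * B = 0"
  obtains C where "A = E2 * C" "B = - (E1 * C)" "\<And>N. total_degree_less (Suc N) A \<Longrightarrow> total_degree_less N C"
proof -
  let ?C = "poly_shift 1 A"
  have "coeff (E1 * A) 0 = 0" using arg_cong[OF assms, of "\<lambda>p. coeff p 0"] by (simp add: coeff_E2_mult)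
  then have "coeff A 0 = 0" by (simp add: E1_def)
  then have A: "A = E2 * ?C"
    by (intro poly_eqI) (simp add: coeff_E2_mult coeff_poly_shift)
  have "E2 * (E1 * ?C + B) = E1 * A + E2 * B" by (subst (2) A) (simp add: algebra_simps)
  then have "E2 * (E1 * ?C + B) = 0" using assms by simp
  then have "B = - (E1 * ?C)" by (simp add: E2_def eq_neg_iff_add_eq_0 add.commute)
  moreover have "total_degree_less N ?C" if "total_degree_less (Suc N) A" for N
    using that by (fastforce simp: total_degree_less_def coeff_poly_shift)
  ultimately show thesis using that A by blast
qed

text \<open>Rebuilds a family from its jumps \<open>l\<^sub>k q\<^sub>k\<close> across the sides,
  starting with 0 at \<open>v\<^sub>m\<close>. The condition \<open>psum l q m = 0\<close> says that
  the family closes up around the polygon.\<close>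

definition psum :: "(nat \<Rightarrow> int poly poly) \<Rightarrow> (nat \<Rightarrow> int poly poly) \<Rightarrow> nat \<Rightarrow> int poly poly" where
  "psum l q k = (\<Sum>j\<in>{1..k}. l j * q j)"

text \<open>
  Induction on the degree of \<open>q\<close>: write \<open>q\<^sub>k = n\<^sub>k + \<epsilon>\<^sub>1\<^sup>* x\<^sub>k + \<epsilon>\<^sub>2\<^sup>* y\<^sub>k\<close>.  Then \<open>\<Sum> l\<^sub>k x\<^sub>k = \<epsilon>\<^sub>2\<^sup>* C\<close> and
  \<open>\<Sum> l\<^sub>k y\<^sub>k = - \<epsilon>\<^sub>1\<^sup>* C\<close> for some \<open>C\<close>, and subtracting \<open>C\<close> times the Koszul syzygy
  \<open>W\<^sub>k \<epsilon>\<^sub>1\<^sup>* - U\<^sub>k \<epsilon>\<^sub>2\<^sup>*\<close> turns \<open>x\<close> and \<open>y\<close> into syzygies of smaller degree.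
\<close>

lemma psum_syzygy:
  fixes T :: "(nat \<Rightarrow> int poly poly) \<Rightarrow> bool" and a b U W :: "nat \<Rightarrow> int"
  assumes l_def: "\<And>k. l k = lform (a k) (b k)"
    and cong: "\<And>p q. (\<And>k. k \<in> {1..m} \<Longrightarrow> p k = q k) \<Longrightarrow> T p \<Longrightarrow> T q"
    and add: "\<And>p q. T p \<Longrightarrow> T q \<Longrightarrow> T (\<lambda>k. p k + q k)"
    and mult: "\<And>p q. T p \<Longrightarrow> T q \<Longrightarrow> T (\<lambda>k. p k * q k)"
    and const: "\<And>p. T (\<lambda>k. p)"
    and U: "(\<Sum>k\<in>{1..m}. of_int (U k) * l k) = E1"
    and W: "(\<Sum>k\<in>{1..m}. of_int (W k) * l k) = E2"
    and lin: "\<And>n. psum l (\<lambda>k. of_int (n k)) m = 0 \<Longrightarrow> T (psum l (\<lambda>k. of_int (n k)))"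
    and kos: "T (psum l (\<lambda>k. of_int (W k) * E1 - of_int (U k) * E2))"
    and q: "psum l q m = 0"
  shows "T (psum l q)"
proof -
  have "T (psum l q)" if "\<And>k. k \<in> {1..m} \<Longrightarrow> total_degree_less N (q k)" "psum l q m = 0" for N q
    using that
  proof (induction N arbitrary: q)
    case 0
    then have z: "q k = 0" if "k \<in> {1..m}" for k
      using that by (auto simp: total_degree_less_def intro!: poly_eqI)
    show ?case by (rule cong[OF _ const[of 0]]) (simp add: psum_def z)
  next
    case (Suc N)
    have "\<exists>n x y. q k = of_int n + E1 * x + E2 * y \<and> (k \<in> {1..m} \<longrightarrow> total_degree_less N x \<and> total_degree_less N y)" for k
      using Suc.prems(1)[of k] by (metis poly_decompose)
    then obtain n x y where q: "\<And>k. q k = of_int (n k) + E1 * x k + E2 * y k"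
      and xy: "\<And>k. k \<in> {1..m} \<Longrightarrow> total_degree_less N (x k)" "\<And>k. k \<in> {1..m} \<Longrightarrow> total_degree_less N (y k)"
      by metis
    define A where "A = psum l x m"
    define B where "B = psum l y m"
    define n' where "n' = (\<lambda>k. of_int (n k) :: int poly poly)"
    define \<alpha> where "\<alpha> = (\<Sum>k\<in>{1..m}. n k * a k)"
    define \<beta> where "\<beta> = (\<Sum>k\<in>{1..m}. n k * b k)"
    have n'm: "psum l n' m = of_int \<beta> * E1 - of_int \<alpha> * E2"
      by (simp add: psum_def n'_def l_def lform_def \<alpha>_def \<beta>_def sum_distrib_left
          right_diff_distrib sum_subtractf mult_ac left_diff_distrib)
    have "psum l n' m + E1 * A + E2 * B = psum l q m"
      by (simp add: psum_def A_def B_def q n'_def sum_distrib_left sum.distrib algebra_simps)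
    then have eq: "of_int \<beta> * E1 - of_int \<alpha> * E2 + E1 * A + E2 * B = 0"
      using Suc.prems(2) n'm by simp
    \<comment> \<open>All \<open>l\<^sub>k\<close> vanish at the origin, so \<open>A\<close> and
      \<open>B\<close> have no constant term. The linear part of \<open>eq\<close> therefore comes
      from \<open>n'\<close> alone, and it must vanish.\<close>
    have z: "coeff (coeff (psum l f m) 0) 0 = 0" for f
    proof -
      have "ev (psum l f m) 0 0 = 0" by (simp add: psum_def ev_sum l_def)
      then show ?thesis by (simp add: ev_def poly_0_coeff_0)
    qed
    have "\<beta> = 0"
      using arg_cong[OF eq, of "\<lambda>p. coeff (coeff p 0) 1"] z[of x]
      by (simp add: coeff_E1_mult coeff_E2_mult A_def) (simp add: E1_def E2_def of_int_poly)
    moreover have "\<alpha> = 0"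
      using arg_cong[OF eq, of "\<lambda>p. coeff (coeff p 1) 0"] z[of y]
      by (simp add: coeff_E1_mult coeff_E2_mult B_def) (simp add: E1_def E2_def of_int_poly)
    ultimately have n'0: "psum l n' m = 0" and AB: "E1 * A + E2 * B = 0"
      using n'm eq by simp_all
    obtain C where C: "A = E2 * C" "B = - (E1 * C)" "\<And>N. total_degree_less (Suc N) A \<Longrightarrow> total_degree_less N C"
      using syzygy_E1_E2[OF AB] by blast
    \<comment> \<open>Multiplication by the \<open>l\<^sub>k\<close> costs one degree and division
      by \<open>E2\<close> gains it back, so the corrected \<open>x'\<close> and \<open>y'\<close>
      keep the bound \<open>N\<close> required by the induction hypothesis.\<close>
    have "total_degree_less N C"
      unfolding A_def psum_def l_def by (rule C(3)[unfolded A_def psum_def l_def])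
        (intro total_degree_less_sum total_degree_less_lform_mult xy)
    define x' where "x' = (\<lambda>k. x k - of_int (W k) * C)"
    define y' where "y' = (\<lambda>k. y k + of_int (U k) * C)"
    define \<kappa> where "\<kappa> = (\<lambda>k. of_int (W k) * E1 - of_int (U k) * E2)"
    have "psum l x' m = A - (\<Sum>k\<in>{1..m}. of_int (W k) * l k) * C"
      by (simp add: psum_def x'_def A_def right_diff_distrib sum_subtractf sum_distrib_left sum_distrib_right mult_ac)
    then have x'0: "psum l x' m = 0" using C(1) W by simp
    have "psum l y' m = B + (\<Sum>k\<in>{1..m}. of_int (U k) * l k) * C"
      by (simp add: psum_def y'_def B_def distrib_left sum.distrib sum_distrib_left sum_distrib_right mult_ac)
    then have y'0: "psum l y' m = 0" using C(2) U by simp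
    have T1: "T (psum l x')"
      by (rule Suc.IH[OF _ x'0]) (simp add: x'_def total_degree_less_diff total_degree_less_of_int_mult xy \<open>total_degree_less N C\<close>)
    have T2: "T (psum l y')"
      by (rule Suc.IH[OF _ y'0]) (simp add: y'_def total_degree_less_add total_degree_less_of_int_mult xy \<open>total_degree_less N C\<close>)
    have T0: "T (psum l n')" using lin n'0 unfolding n'_def by blast
    have "q k = n' k + E1 * x' k + E2 * y' k + C * \<kappa> k" for k
      by (simp add: q n'_def x'_def y'_def \<kappa>_def algebra_simps)
    then have "psum l q = (\<lambda>k. psum l n' k + E1 * psum l x' k + E2 * psum l y' k + C * psum l \<kappa> k)"
      by (simp add: psum_def fun_eq_iff sum_distrib_left sum.distrib distrib_left mult_ac)
    moreover have "T \<dots>"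
      using T0 T1 T2 kos unfolding \<kappa>_def by (intro add mult const)
    ultimately show ?case by simp
  qed
  moreover have "\<exists>N. \<forall>k\<in>{1..m}. total_degree_less N (q k)"
  proof -
    have "\<exists>N. total_degree_less N p" for p
    proof -
      define N where "N = Suc (degree p + Max ((\<lambda>i. degree (coeff p i)) ` {..degree p}))"
      have "i + j < N" if "coeff (coeff p i) j \<noteq> 0" for i j
      proof -
        have "i \<le> degree p" using that by (intro le_degree) auto
        moreover have "j \<le> degree (coeff p i)" using that by (rule le_degree)
        moreover have "degree (coeff p i) \<le> Max ((\<lambda>i. degree (coeff p i)) ` {..degree p})"
          using \<open>i \<le> degree p\<close> by (intro Max_ge) auto
        ultimately show ?thesis unfolding N_def by linarith
      qed
      then show ?thesis unfolding total_degree_less_def by blast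
    qed
    then have "\<forall>k. \<exists>N. total_degree_less N (q k)" by blast
    from choice[OF this] obtain N where N: "\<forall>k. total_degree_less (N k) (q k)" ..
    have "total_degree_less (\<Sum>k\<in>{1..m}. N k) (q k)" if "k \<in> {1..m}" for k
    proof -
      have "N k \<le> (\<Sum>k\<in>{1..m}. N k)" using that by (intro member_le_sum) auto
      then show ?thesis using N unfolding total_degree_less_def by (meson less_le_trans)
    qed
    then show ?thesis by blast
  qed
  ultimately show ?thesis using q by blast
qed

section \<open>The lattice conditions\<close>

text \<open>Treats both shapes of the matrix at once. \<open>S\<close> sits in rows \<open>h\<close>
  to \<open>h + n\<close> and columns \<open>p 0\<close> to \<open>p n\<close>; every other column
  \<open>i\<close> has a single 1, in row \<open>\<sigma> i\<close>, and \<open>\<tau>\<close> leads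
  from that row back to the column. The remaining coordinates are thus free, and only the block
  constrains \<open>c\<close>.\<close>

lemma transpose_block_range:
  fixes M S :: "int mat" and \<sigma> \<tau> :: "nat \<Rightarrow> nat"
  assumes M: "M \<in> carrier_mat d d" and on: "h + n < d"
    and p: "\<And>j. j \<le> n \<Longrightarrow> p j < d"
    and block: "\<And>j r. j \<le> n \<Longrightarrow> r < d \<Longrightarrow>
      M $$ (r, p j) = (if h \<le> r \<and> r \<le> h + n then S $$ (r - h, j) else 0)"
    and \<sigma>: "\<And>i. i < d \<Longrightarrow> i \<notin> p ` {..n} \<Longrightarrow> \<sigma> i < d \<and> (\<sigma> i < h \<or> h + n < \<sigma> i) \<and> \<tau> (\<sigma> i) = i"
    and ones: "\<And>i r. i < d \<Longrightarrow> i \<notin> p ` {..n} \<Longrightarrow> r < d \<Longrightarrow> M $$ (r, i) = (if r = \<sigma> i then 1 else 0)"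
  shows "c \<in> {transpose_mat M *\<^sub>v w | w. w \<in> carrier_vec d} \<longleftrightarrow>
    dim_vec c = d \<and> (\<exists>w. \<forall>j\<le>n. c $ p j = (\<Sum>t\<le>n. w t * S $$ (t, j)))"
proof -
  have idx: "(transpose_mat M *\<^sub>v w) $ i = (\<Sum>r<d. M $$ (r, i) * w $ r)"
    if "w \<in> carrier_vec d" "i < d" for w i
    using M that by (simp add: scalar_prod_def atLeast0LessThan)
  have sum_block: "(\<Sum>r<d. M $$ (r, p j) * w r) = (\<Sum>t\<le>n. w (h + t) * S $$ (t, j))" if "j \<le> n" for w j
  proof -
    have "(\<Sum>r<d. M $$ (r, p j) * w r) = (\<Sum>r\<in>{h..h+n}. M $$ (r, p j) * w r)"
      using on that block by (intro sum.mono_neutral_right) auto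
    also have "\<dots> = (\<Sum>t\<le>n. w (h + t) * S $$ (t, j))"
      using on that block
      by (intro sum.reindex_bij_witness[of _ "\<lambda>t. h + t" "\<lambda>r. r - h"]) (auto simp: mult.commute)
    finally show ?thesis .
  qed
  show ?thesis
  proof
    assume "c \<in> {transpose_mat M *\<^sub>v w | w. w \<in> carrier_vec d}"
    then obtain w where w: "w \<in> carrier_vec d" "c = transpose_mat M *\<^sub>v w" by blast
    then have "\<forall>j\<le>n. c $ p j = (\<Sum>t\<le>n. w $ (h + t) * S $$ (t, j))"
      using idx p sum_block[of _ "\<lambda>r. w $ r"] by simp
    moreover have "dim_vec c = d" using w M by simp
    ultimately show "dim_vec c = d \<and> (\<exists>w. \<forall>j\<le>n. c $ p j = (\<Sum>t\<le>n. w t * S $$ (t, j)))"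
      by (intro conjI exI[of _ "\<lambda>t. w $ (h + t)"])
  next
    assume "dim_vec c = d \<and> (\<exists>w. \<forall>j\<le>n. c $ p j = (\<Sum>t\<le>n. w t * S $$ (t, j)))"
    then obtain w where c: "dim_vec c = d" and w: "\<And>j. j \<le> n \<Longrightarrow> c $ p j = (\<Sum>t\<le>n. w t * S $$ (t, j))"
      by blast
    \<comment> \<open>Block rows take the given coefficients; every other row has to reproduce the
      entry of \<open>c\<close> in the column of its 1.\<close>
    define v where "v = (\<lambda>r. if h \<le> r \<and> r \<le> h + n then w (r - h) else c $ \<tau> r)"
    have "transpose_mat M *\<^sub>v Matrix.vec d v = c"
    proof (rule eq_vecI)
      fix i assume "i < dim_vec c"
      then have i: "i < d" using c by simp
      have "(transpose_mat M *\<^sub>v Matrix.vec d v) $ i = (\<Sum>r<d. M $$ (r, i) * v r)"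
        using idx[of "Matrix.vec d v" i] i by simp
      also have "\<dots> = c $ i"
      proof (cases "i \<in> p ` {..n}")
        case True
        then obtain j where j: "j \<le> n" "i = p j" by auto
        show ?thesis
          unfolding j(2) sum_block[OF j(1)] w[OF j(1)] by (simp add: v_def)
      next
        case False
        have "(\<Sum>r<d. M $$ (r, i) * v r) = (\<Sum>r<d. if r = \<sigma> i then v r else 0)"
          using ones[OF i False] by (intro sum.cong) auto
        then show ?thesis using \<sigma>[OF i False] by (auto simp: v_def)
      qed
      finally show "(transpose_mat M *\<^sub>v Matrix.vec d v) $ i = c $ i" .
    qed (use c M in auto)
    then show "c \<in> {transpose_mat M *\<^sub>v w | w. w \<in> carrier_vec d}"
      by (intro CollectI exI[of _ "Matrix.vec d v"]) auto
  qed
qed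

text \<open>The positions of the coefficients at \<open>v\<^sub>k\<close>; the last one at \<open>v\<^sub>m\<close> wraps around to position 0.\<close>

definition block_pos :: "nat \<Rightarrow> nat \<Rightarrow> nat \<Rightarrow> nat \<Rightarrow> nat" where
  "block_pos m n k j = (if k = m \<and> j = n then 0 else n * (k - 1) + j)"

lemma dim_Phi [simp]: "dim_row (Phi n A) = n + 1" "dim_col (Phi n A) = n + 1"
  by (simp_all add: Phi_def)

text \<open>Lattice membership concerns only the coefficients at \<open>v\<^sub>k\<close>: they must
  be those of an integral form of degree \<open>n\<close>, with coefficients \<open>w\<close>,
  expanded in the two weights.\<close>

lemma LL_iff:
  assumes m: "m \<ge> 2" and n: "n \<ge> 1" and k: "k \<in> {1..m}"
  shows "c \<in> LL m lam n k \<longleftrightarrow> dim_vec c = n * m \<and>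
    (\<exists>w. \<forall>j\<le>n. c $ block_pos m n k j = (\<Sum>t\<le>n. w t * Phi n (Lam m lam k) $$ (t, j)))"
proof (cases "k < m")
  case True
  define A where "A = n * (k - 1)"
  \<comment> \<open>The subtraction does not truncate, as \<open>n \<ge> 1\<close> and
    \<open>k < m\<close>; so the three blocks have total size \<open>n * m\<close>.\<close>
  define B where "B = n * (m - k) - 1"
  obtain e where e: "m = k + Suc e" using True less_iff_Suc_add by auto
  obtain f where f: "k = Suc f" using k by (cases k) auto
  have nm: "n * m = A + (n + 1) + B"
    using n by (simp add: A_def B_def e f algebra_simps)
  define M where "M = diag_block_mat [1\<^sub>m A, Phi n (Lam m lam k), 1\<^sub>m B]"
  have M: "M \<in> carrier_mat (n * m) (n * m)"
    unfolding M_def by (rule carrier_matI; simp only: dim_diag_block_mat; simp add: nm)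
  have idx: "M $$ (r, i) = (if r < A then (if i = r then 1 else 0)
      else if r \<le> A + n then (if A \<le> i \<and> i \<le> A + n then Phi n (Lam m lam k) $$ (r - A, i - A) else 0)
      else (if i = r then 1 else 0))" if "r < n * m" "i < n * m" for r i
    using that by (auto simp: nm Let_def M_def)
  have pos: "block_pos m n k j = A + j" for j
    using True by (simp add: block_pos_def A_def)
  have im: "block_pos m n k ` {..n} = {A..A+n}"
    unfolding pos atMost_atLeast0 by simp
  show ?thesis
    unfolding LL_def tilde_Lam_def if_P[OF True] A_def[symmetric] B_def[symmetric] M_def[symmetric]
  proof (rule transpose_block_range[where h = A and \<sigma> = "\<lambda>i. i" and \<tau> = "\<lambda>i. i", OF M], unfold im)
    fix j r assume "j \<le> n" "r < n * m"
    then show "M $$ (r, block_pos m n k j) =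
        (if A \<le> r \<and> r \<le> A + n then Phi n (Lam m lam k) $$ (r - A, j) else 0)"
      using nm idx[of r "A + j"] by (auto simp: pos)
  next
    fix i r assume "i < n * m" "i \<notin> {A..A+n}" "r < n * m"
    then show "M $$ (r, i) = (if r = i then 1 else 0)"
      using idx[of r i] by auto
  qed (use nm in \<open>auto simp: pos\<close>)
next
  case False
  then have km: "k = m" using k by simp
  \<comment> \<open>The identity block fills the rows below \<open>N\<close> and the columns 1 to
    \<open>N\<close>. Column 0 belongs to the last coefficient at \<open>v\<^sub>m\<close>, hence
    the shifts by one in \<open>\<sigma>\<close> and \<open>\<tau>\<close> below.\<close>
  define N where "N = n * (m - 1) - 1"
  obtain e where e: "m = Suc (Suc e)" using m less_iff_Suc_add[of 1 m] by auto
  have nm: "n * m = N + (n + 1)" and N: "n * (m - 1) = N + 1"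
    using n by (simp_all add: N_def e algebra_simps)
  define M where "M = Matrix.mat (n * m) (n * m) (\<lambda>(i, j).
          if i < N then (if j = i + 1 then 1 else 0)
          else if j = 0 then Phi n (Lam m lam m) $$ (i - N, n)
          else if j \<le> N then 0
          else Phi n (Lam m lam m) $$ (i - N, j - (N + 1)))"
  have tM: "tilde_Lam m lam n k = M"
    unfolding tilde_Lam_def km M_def N_def Let_def by (simp del: One_nat_def)
  have M: "M \<in> carrier_mat (n * m) (n * m)"
    by (simp add: M_def)
  have pos: "block_pos m n k j = (if j = n then 0 else N + 1 + j)" for j
    by (simp add: block_pos_def km N del: One_nat_def)
  have im: "i \<in> block_pos m n k ` {..n} \<longleftrightarrow> i = 0 \<or> N < i" if "i < n * m" for i
  proof
    assume "i = 0 \<or> N < i"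
    then show "i \<in> block_pos m n k ` {..n}"
    proof
      assume "N < i"
      then have "i = block_pos m n k (i - (N + 1))" "i - (N + 1) \<le> n"
        using that nm by (auto simp: pos)
      then show ?thesis by blast
    qed (auto simp: pos image_iff intro!: bexI[of _ n])
  qed (auto simp: pos split: if_splits)
  show ?thesis
    unfolding LL_def tM
  proof (rule transpose_block_range[where h = N and \<sigma> = "\<lambda>i. i - 1" and \<tau> = "\<lambda>i. i + 1", OF M])
    fix j r assume "j \<le> n" "r < n * m"
    then show "M $$ (r, block_pos m n k j) =
        (if N \<le> r \<and> r \<le> N + n then Phi n (Lam m lam k) $$ (r - N, j) else 0)"
      unfolding pos using nm by (auto simp: M_def km)
  next
    fix i assume i: "i < n * m" "i \<notin> block_pos m n k ` {..n}"
    then have "0 < i" "i \<le> N" using im by auto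
    then show "i - 1 < n * m \<and> (i - 1 < N \<or> N + n < i - 1) \<and> i - 1 + 1 = i" using i by auto
    fix r assume "r < n * m"
    then show "M $$ (r, i) = (if r = i - 1 then 1 else 0)"
      using \<open>0 < i\<close> \<open>i \<le> N\<close> i(1) by (auto simp: M_def)
  qed (use nm in \<open>auto simp: pos\<close>)
qed

lemma Lam_index [simp]:
  "Lam m lam k $$ (0, 0) = ca lam k" "Lam m lam k $$ (0, Suc 0) = ca lam (nxt m k)"
  "Lam m lam k $$ (Suc 0, 0) = cb lam k" "Lam m lam k $$ (Suc 0, Suc 0) = cb lam (nxt m k)"
  by (simp_all add: Lam_def mat_of_rows_list_def)

lemma LL1_iff:
  assumes "m \<ge> 2" "k \<in> {1..m}"
  shows "c \<in> LL m lam 1 k \<longleftrightarrow> dim_vec c = m \<and> (\<exists>r s.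
    c $ (k - 1) = r * ca lam k + s * cb lam k \<and>
    c $ (nxt m k - 1) = r * ca lam (nxt m k) + s * cb lam (nxt m k))"
proof -
  have pos: "block_pos m 1 k 0 = k - 1" "block_pos m 1 k (Suc 0) = nxt m k - 1"
    using assms by (auto simp: block_pos_def nxt_def)
  have all: "(\<forall>j\<le>1. P j) \<longleftrightarrow> P 0 \<and> P (Suc 0)" for P :: "nat \<Rightarrow> bool"
    by (auto simp: le_Suc_eq)
  have ex: "(\<exists>w. P (w 0) (w (Suc 0))) \<longleftrightarrow> (\<exists>r s. P r s)" for P :: "int \<Rightarrow> int \<Rightarrow> bool"
  proof
    assume "\<exists>r s. P r s"
    then obtain r s where "P r s" by blast
    then show "\<exists>w. P (w 0) (w (Suc 0))" by (intro exI[of _ "\<lambda>t. if t = 0 then r else s"]) simp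
  qed blast
  show ?thesis
    unfolding LL_iff[OF assms(1) order.refl assms(2)] all pos mult_1 ex[symmetric]
    by (simp add: Phi_def)
qed

text \<open>The outer two numbers are the values of the quadratic form with coefficients
  \<open>r, s, t\<close> on the two characteristic vectors; the middle one is its polarisation on
  this pair, that is, the coefficient of the product of the weights.\<close>

lemma LL2_iff:
  assumes "m \<ge> 2" "k \<in> {1..m}"
  shows "c \<in> LL m lam 2 k \<longleftrightarrow> dim_vec c = 2 * m \<and> (\<exists>r s t.
    c $ (2 * (k - 1)) = r * ca lam k ^ 2 + s * (ca lam k * cb lam k) + t * cb lam k ^ 2 \<and>
    c $ (2 * (k - 1) + 1) = r * (2 * ca lam k * ca lam (nxt m k))
      + s * (ca lam k * cb lam (nxt m k) + ca lam (nxt m k) * cb lam k)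
      + t * (2 * cb lam k * cb lam (nxt m k)) \<and>
    c $ (2 * (nxt m k - 1)) = r * ca lam (nxt m k) ^ 2
      + s * (ca lam (nxt m k) * cb lam (nxt m k)) + t * cb lam (nxt m k) ^ 2)"
proof -
  have pos: "block_pos m 2 k 0 = 2 * (k - 1)" "block_pos m 2 k (Suc 0) = 2 * (k - 1) + 1"
    "block_pos m 2 k (Suc (Suc 0)) = 2 * (nxt m k - 1)"
    using assms by (auto simp: block_pos_def nxt_def)
  have all: "(\<forall>j\<le>2. P j) \<longleftrightarrow> P 0 \<and> P (Suc 0) \<and> P (Suc (Suc 0))" for P :: "nat \<Rightarrow> bool"
    by (auto simp: le_Suc_eq numeral_2_eq_2)
  have ex: "(\<exists>w. P (w 0) (w (Suc 0)) (w (Suc (Suc 0)))) \<longleftrightarrow> (\<exists>r s t. P r s t)" for P :: "int \<Rightarrow> int \<Rightarrow> int \<Rightarrow> bool"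
  proof
    assume "\<exists>r s t. P r s t"
    then obtain r s t where "P r s t" by blast
    then show "\<exists>w. P (w 0) (w (Suc 0)) (w (Suc (Suc 0)))"
      by (intro exI[of _ "\<lambda>i. if i = 0 then r else if i = 1 then s else t"]) simp
  qed blast
  have sum: "(\<Sum>t\<le>2. f t) = f 0 + f (Suc 0) + f (Suc (Suc 0))" for f :: "nat \<Rightarrow> int"
    by (simp add: numeral_2_eq_2)
  have two: "(1::nat) \<le> 2" by simp
  show ?thesis
    unfolding LL_iff[OF assms(1) two assms(2)] all pos sum ex[symmetric]
    by (simp add: Phi_def power2_eq_square algebra_simps numeral_2_eq_2)
qed

section \<open>The generators\<close>

lemma ZGa_iff: "f \<in> carrier (ZGa m lam) \<longleftrightarrow> f \<in> PP m \<and> (\<forall>v\<in>{1..m}. mu m lam f v \<in> range iota)"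
  by (simp add: ZGa_def HBT_eq_range_iota)

lemma mu_edge_sum:
  assumes "m \<ge> 2" "k \<in> {1..m}" "n \<ge> 1"
  shows "mu m lam (\<Sum>i\<in>{1..m}. of_int (d i) * xg (Edge i) ^ n) k =
    of_int (d k) * yv m lam k ^ n + of_int (d (nxt m k)) * zv m lam k ^ n"
proof -
  have "mu m lam (\<Sum>i\<in>{1..m}. of_int (d i) * xg (Edge i) ^ n) k =
    (\<Sum>i\<in>{1..m}. (if i = k then of_int (d k) * yv m lam k ^ n else 0) +
      (if i = nxt m k then of_int (d (nxt m k)) * zv m lam k ^ n else 0))"
    using assms nxt_neq[OF assms(1,2)] by (auto simp: mu_xg tau_Edge intro!: sum.cong)
  also have "\<dots> = of_int (d k) * yv m lam k ^ n + of_int (d (nxt m k)) * zv m lam k ^ n"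
    using assms nxt_in[OF assms(2)] by (simp add: sum.distrib del: atLeastAtMost_iff)
  finally show ?thesis .
qed

lemma mu_quad_monomial:
  assumes "m \<ge> 2" "k \<in> {1..m}" "i \<in> {1..m}"
  shows "mu m lam (quad_monomial m 1 i) k = (if i = k then yv m lam k * zv m lam k else 0)"
proof (cases "m = 2")
  case True
  then show ?thesis using assms by (simp add: quad_monomial_def mu_xg tau_Vertex)
next
  case False
  \<comment> \<open>Each of two vertices follows the other only in the bigon. This is the point at
    which a product of sides stops being supported at one vertex.\<close>
  have "\<not> (i = nxt m k \<and> nxt m i = k)"
    using assms False by (auto simp: nxt_def split: if_splits)
  moreover have "\<not> (i = nxt m k \<and> nxt m i = nxt m k)" "nxt m k \<noteq> k"
    using nxt_neq[OF assms(1), of i] nxt_neq[OF assms(1), of k] assms by auto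
  ultimately show ?thesis
    using False assms nxt_in[OF assms(3)]
    by (auto simp: quad_monomial_def mu_xg tau_Edge)
qed

lemma mu_vertex_sum:
  assumes "m \<ge> 2" "k \<in> {1..m}"
  shows "mu m lam (\<Sum>i\<in>{1..m}. of_int (d i) * quad_monomial m 1 i) k =
    of_int (d k) * (yv m lam k * zv m lam k)"
proof -
  have "mu m lam (\<Sum>i\<in>{1..m}. of_int (d i) * quad_monomial m 1 i) k =
    (\<Sum>i\<in>{1..m}. if i = k then of_int (d k) * (yv m lam k * zv m lam k) else 0)"
    unfolding mu_sum
    by (rule sum.cong) (simp_all add: mu_quad_monomial[OF assms] del: One_nat_def atLeastAtMost_iff)
  then show ?thesis using assms by (simp del: atLeastAtMost_iff)
qed

lemma PP_quad_monomial: "i \<in> {1..m} \<Longrightarrow> quad_monomial m t i \<in> PP m"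
  using nxt_in[of i m] by (auto simp: quad_monomial_def intro!: PP_mult PP_power PP_xg)

definition gen2 :: "nat \<Rightarrow> int Matrix.vec \<Rightarrow> zpoly" where
  "gen2 m c = (\<Sum>i\<in>{1..m}. of_int (c $ (i - 1)) * xg (Edge i))"

definition gen4 :: "nat \<Rightarrow> int Matrix.vec \<Rightarrow> zpoly" where
  "gen4 m c = (\<Sum>i\<in>{1..m}. of_int (c $ (2 * (i - 1))) * xg (Edge i) ^ 2) +
    (\<Sum>i\<in>{1..m}. of_int (c $ (2 * (i - 1) + 1)) * quad_monomial m 1 i)"

lemma generators2_eq: "generators2 m lam = gen2 m ` (\<Inter>k\<in>{1..m}. LL m lam 1 k)"
  unfolding generators2_def gen2_def zconst_eq_of_int by blast

lemma generators4_eq: "generators4 m lam = gen4 m ` (\<Inter>k\<in>{1..m}. LL m lam 2 k)"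
proof -
  have "(\<Sum>t\<in>{0, 1}. \<Sum>i\<in>{1..m}. zconst (c $ (2 * (i - 1) + t)) * quad_monomial m t i) = gen4 m c" for c
    by (simp add: gen4_def zconst_eq_of_int quad_monomial_def[of m 0])
  then show ?thesis unfolding generators4_def by auto
qed

lemma mu_gen2:
  assumes "m \<ge> 2" "characteristic_function m lam" "k \<in> {1..m}"
    and "c $ (k - 1) = r * ca lam k + s * cb lam k"
    and "c $ (nxt m k - 1) = r * ca lam (nxt m k) + s * cb lam (nxt m k)"
  shows "mu m lam (gen2 m c) k = iota (of_int r * E1 + of_int s * E2)"
proof -
  have "mu m lam (gen2 m c) k = of_int (c $ (k - 1)) * yv m lam k + of_int (c $ (nxt m k - 1)) * zv m lam k"
    unfolding gen2_def using mu_edge_sum[OF assms(1,3), of 1 lam "\<lambda>i. c $ (i - 1)"] by simp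
  also have "\<dots> = iota (of_int r * E1 + of_int s * E2)"
    unfolding assms(4,5) by (simp add: eps_eq[OF assms(2,3)] algebra_simps)
  finally show ?thesis .
qed

lemma mu_gen4:
  assumes "m \<ge> 2" "characteristic_function m lam" "k \<in> {1..m}"
    and "c $ (2 * (k - 1)) = r * ca lam k ^ 2 + s * (ca lam k * cb lam k) + t * cb lam k ^ 2"
    and "c $ (2 * (k - 1) + 1) = r * (2 * ca lam k * ca lam (nxt m k))
      + s * (ca lam k * cb lam (nxt m k) + ca lam (nxt m k) * cb lam k)
      + t * (2 * cb lam k * cb lam (nxt m k))"
    and "c $ (2 * (nxt m k - 1)) = r * ca lam (nxt m k) ^ 2
      + s * (ca lam (nxt m k) * cb lam (nxt m k)) + t * cb lam (nxt m k) ^ 2"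
  shows "mu m lam (gen4 m c) k = iota (of_int r * E1 ^ 2 + of_int s * (E1 * E2) + of_int t * E2 ^ 2)"
proof -
  have "mu m lam (gen4 m c) k = of_int (c $ (2 * (k - 1))) * yv m lam k ^ 2
      + of_int (c $ (2 * (nxt m k - 1))) * zv m lam k ^ 2
      + of_int (c $ (2 * (k - 1) + 1)) * (yv m lam k * zv m lam k)"
    unfolding gen4_def mu_add using mu_edge_sum[OF assms(1,3), of 2 lam "\<lambda>i. c $ (2 * (i - 1))"]
      mu_vertex_sum[OF assms(1,3), of lam "\<lambda>i. c $ (2 * (i - 1) + 1)"] by simp
  also have "\<dots> = iota (of_int r * E1 ^ 2 + of_int s * (E1 * E2) + of_int t * E2 ^ 2)"
    unfolding assms(4-6) by (simp add: eps_eq[OF assms(2,3)] algebra_simps power2_eq_square)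
  finally show ?thesis .
qed

lemma gen2_in_ZGa:
  assumes "m \<ge> 2" "characteristic_function m lam" "c \<in> (\<Inter>k\<in>{1..m}. LL m lam 1 k)"
  shows "gen2 m c \<in> carrier (ZGa m lam)"
  unfolding ZGa_iff
proof (intro conjI ballI)
  show "gen2 m c \<in> PP m" unfolding gen2_def by (intro PP_sum PP_mult PP_of_int PP_xg) simp
  fix k assume k: "k \<in> {1..m}"
  then have "c \<in> LL m lam 1 k" using assms(3) by blast
  then obtain r s where "c $ (k - 1) = r * ca lam k + s * cb lam k"
    "c $ (nxt m k - 1) = r * ca lam (nxt m k) + s * cb lam (nxt m k)"
    unfolding LL1_iff[OF assms(1) k] by blast
  from mu_gen2[OF assms(1,2) k this] show "mu m lam (gen2 m c) k \<in> range iota" by blast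
qed

lemma gen4_in_ZGa:
  assumes "m \<ge> 2" "characteristic_function m lam" "c \<in> (\<Inter>k\<in>{1..m}. LL m lam 2 k)"
  shows "gen4 m c \<in> carrier (ZGa m lam)"
  unfolding ZGa_iff
proof (intro conjI ballI)
  show "gen4 m c \<in> PP m" unfolding gen4_def
    by (intro PP_add PP_sum PP_mult PP_of_int PP_power PP_xg PP_quad_monomial) simp_all
  fix k assume k: "k \<in> {1..m}"
  then have "c \<in> LL m lam 2 k" using assms(3) by blast
  then obtain r s t where
    "c $ (2 * (k - 1)) = r * ca lam k ^ 2 + s * (ca lam k * cb lam k) + t * cb lam k ^ 2"
    "c $ (2 * (k - 1) + 1) = r * (2 * ca lam k * ca lam (nxt m k))
      + s * (ca lam k * cb lam (nxt m k) + ca lam (nxt m k) * cb lam k)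
      + t * (2 * cb lam k * cb lam (nxt m k))"
    "c $ (2 * (nxt m k - 1)) = r * ca lam (nxt m k) ^ 2
      + s * (ca lam (nxt m k) * cb lam (nxt m k)) + t * cb lam (nxt m k) ^ 2"
    unfolding LL2_iff[OF assms(1) k] by blast
  from mu_gen4[OF assms(1,2) k this] show "mu m lam (gen4 m c) k \<in> range iota" by blast
qed

text \<open>By \<open>compat\<close> the forms at both ends of a side have the same value on its
  characteristic vector, and this common value is taken as the coefficient of the side.\<close>

lemma piecewise_linear_generator:
  assumes m: "m \<ge> 2" and char: "characteristic_function m lam"
    and compat: "\<And>k. k \<in> {1..m} \<Longrightarrow>
      r (prv m k) * ca lam k + s (prv m k) * cb lam k = r k * ca lam k + s k * cb lam k"
  obtains g where "g \<in> generators2 m lam"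
    "\<And>k. k \<in> {1..m} \<Longrightarrow> mu m lam g k = iota (of_int (r k) * E1 + of_int (s k) * E2)"
proof -
  define c where "c = Matrix.vec m (\<lambda>i. r (Suc i) * ca lam (Suc i) + s (Suc i) * cb lam (Suc i))"
  have c: "c $ (k - 1) = r k * ca lam k + s k * cb lam k" if k: "k \<in> {1..m}" for k
  proof -
    have "k - 1 < m" "Suc (k - 1) = k" using k by auto
    then show ?thesis by (simp add: c_def)
  qed
  have c': "c $ (nxt m k - 1) = r k * ca lam (nxt m k) + s k * cb lam (nxt m k)" if "k \<in> {1..m}" for k
    using c[OF nxt_in[OF that]] compat[OF nxt_in[OF that]] by (simp add: prv_nxt[OF that])
  have "c \<in> LL m lam 1 k" if "k \<in> {1..m}" for k
    unfolding LL1_iff[OF m that] using c c' that by (auto simp: c_def)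
  then have "gen2 m c \<in> generators2 m lam" unfolding generators2_eq by blast
  then show thesis using that mu_gen2[OF m char _ c c'] by blast
qed

text \<open>As in the linear case for the squares of the sides; a mixed coefficient belongs to a
  single vertex, so no compatibility is asked of it.\<close>

lemma piecewise_quadratic_generator:
  assumes m: "m \<ge> 2" and char: "characteristic_function m lam"
    and compat: "\<And>k. k \<in> {1..m} \<Longrightarrow>
      r (prv m k) * ca lam k ^ 2 + s (prv m k) * (ca lam k * cb lam k) + t (prv m k) * cb lam k ^ 2
      = r k * ca lam k ^ 2 + s k * (ca lam k * cb lam k) + t k * cb lam k ^ 2"
  obtains g where "g \<in> generators4 m lam"
    "\<And>k. k \<in> {1..m} \<Longrightarrow>
      mu m lam g k = iota (of_int (r k) * E1 ^ 2 + of_int (s k) * (E1 * E2) + of_int (t k) * E2 ^ 2)"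
proof -
  define c where "c = Matrix.vec (2 * m) (\<lambda>i. let k = Suc (i div 2) in
    if even i then r k * ca lam k ^ 2 + s k * (ca lam k * cb lam k) + t k * cb lam k ^ 2
    else r k * (2 * ca lam k * ca lam (nxt m k))
      + s k * (ca lam k * cb lam (nxt m k) + ca lam (nxt m k) * cb lam k)
      + t k * (2 * cb lam k * cb lam (nxt m k)))"
  have c: "c $ (2 * (k - 1)) = r k * ca lam k ^ 2 + s k * (ca lam k * cb lam k) + t k * cb lam k ^ 2"
    if k: "k \<in> {1..m}" for k
  proof -
    have "2 * (k - 1) < 2 * m" "Suc (k - 1) = k" using k by auto
    then show ?thesis by (simp add: c_def)
  qed
  have c2: "c $ (2 * (k - 1) + 1) = r k * (2 * ca lam k * ca lam (nxt m k))
      + s k * (ca lam k * cb lam (nxt m k) + ca lam (nxt m k) * cb lam k)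
      + t k * (2 * cb lam k * cb lam (nxt m k))" if k: "k \<in> {1..m}" for k
  proof -
    have "2 * (k - 1) + 1 < 2 * m" "(2 * (k - 1) + 1) div 2 = k - 1" "Suc (k - 1) = k" using k by auto
    then show ?thesis by (simp add: c_def)
  qed
  have c': "c $ (2 * (nxt m k - 1)) = r k * ca lam (nxt m k) ^ 2
      + s k * (ca lam (nxt m k) * cb lam (nxt m k)) + t k * cb lam (nxt m k) ^ 2" if "k \<in> {1..m}" for k
    using c[OF nxt_in[OF that]] compat[OF nxt_in[OF that]] by (simp add: prv_nxt[OF that])
  have "c \<in> LL m lam 2 k" if "k \<in> {1..m}" for k
    unfolding LL2_iff[OF m that]
    by (intro conjI exI[of _ "r k"] exI[of _ "s k"] exI[of _ "t k"] c[OF that] c2[OF that] c'[OF that])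
      (simp add: c_def)
  then have "gen4 m c \<in> generators4 m lam" unfolding generators4_eq by blast
  then show thesis using that mu_gen4[OF m char _ c c2 c'] by blast
qed

section \<open>The quotient ring\<close>

lemma Gcd_int_bezout:
  fixes d :: "'a \<Rightarrow> int"
  assumes "finite A"
  shows "\<exists>r. (\<Sum>k\<in>A. r k * d k) = Gcd (d ` A)"
  using assms
proof induction
  case (insert x A)
  then obtain r where r: "(\<Sum>k\<in>A. r k * d k) = Gcd (d ` A)" by blast
  obtain u v where uv: "u * d x + v * Gcd (d ` A) = gcd (d x) (Gcd (d ` A))"
    using bezout_int by blast
  have "(\<Sum>k\<in>insert x A. ((\<lambda>k. v * r k)(x := u)) k * d k) = u * d x + (\<Sum>k\<in>A. v * r k * d k)"
    using insert by (subst sum.insert) (auto intro!: sum.cong)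
  also have "(\<Sum>k\<in>A. v * r k * d k) = v * (\<Sum>k\<in>A. r k * d k)"
    by (simp add: sum_distrib_left mult.assoc)
  finally show ?case using uv r by (auto simp: exI)
qed simp

text \<open>The gcd condition is reduced to the span condition: by Cramer's rule
  \<open>D\<^sub>k\<close> times any vector is an integral combination of two neighbouring
  characteristic vectors, and a Bezout combination of the \<open>D\<^sub>k\<close> is 1.\<close>

lemma characteristic_vectors_span:
  assumes "Modules.module.span zscale (lam ` {1..m}) = UNIV \<or> Gcd (DD m lam ` {1..m}) = 1"
  obtains u where "(\<Sum>k\<in>{1..m}. u k * ca lam k) = x" "(\<Sum>k\<in>{1..m}. u k * cb lam k) = y"
proof -
  interpret Z: Modules.module zscale by (rule module_zscale)
  define S where "S = {v. \<exists>u. (\<Sum>k\<in>{1..m}. u k * ca lam k) = fst v \<and> (\<Sum>k\<in>{1..m}. u k * cb lam k) = snd v}"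
  have S: "Z.subspace S"
  proof (rule Z.subspaceI)
    show "0 \<in> S" by (auto simp: S_def intro!: exI[of _ "\<lambda>_. 0"])
    fix v w assume "v \<in> S" "w \<in> S"
    then obtain u u' where "(\<Sum>k\<in>{1..m}. u k * ca lam k) = fst v" "(\<Sum>k\<in>{1..m}. u k * cb lam k) = snd v"
      "(\<Sum>k\<in>{1..m}. u' k * ca lam k) = fst w" "(\<Sum>k\<in>{1..m}. u' k * cb lam k) = snd w"
      unfolding S_def by blast
    then show "v + w \<in> S"
      by (auto simp: S_def distrib_right sum.distrib intro!: exI[of _ "\<lambda>k. u k + u' k"])
  next
    fix c v assume "v \<in> S"
    then obtain u where "(\<Sum>k\<in>{1..m}. u k * ca lam k) = fst v" "(\<Sum>k\<in>{1..m}. u k * cb lam k) = snd v"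
      unfolding S_def by blast
    then show "zscale c v \<in> S"
      by (auto simp: S_def zscale_def mult.assoc simp flip: sum_distrib_left intro!: exI[of _ "\<lambda>k. c * u k"])
  qed
  have lam: "lam k \<in> S" if "k \<in> {1..m}" for k
  proof -
    have *: "(if i = k then 1 else 0) * c = (if i = k then c else 0)" for i and c :: int by simp
    show ?thesis using that unfolding S_def
      by (auto simp: ca_def cb_def * intro!: exI[of _ "\<lambda>i. if i = k then 1 else 0"])
  qed
  have "(x, y) \<in> S"
    using assms
  proof
    assume "Z.span (lam ` {1..m}) = UNIV"
    moreover have "Z.span (lam ` {1..m}) \<subseteq> S"
      by (rule Z.span_minimal) (use lam S in auto)
    ultimately show ?thesis by blast
  next
    assume "Gcd (DD m lam ` {1..m}) = 1"
    then obtain r where r: "(\<Sum>k\<in>{1..m}. r k * DD m lam k) = 1"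
      using Gcd_int_bezout[of "{1..m}" "DD m lam"] by auto
    have D: "zscale (DD m lam k) (x, y) \<in> S" if k: "k \<in> {1..m}" for k
    proof -
      have "zscale (DD m lam k) (x, y) =
        zscale (x * cb lam (nxt m k) - y * ca lam (nxt m k)) (lam k)
        + zscale (y * ca lam k - x * cb lam k) (lam (nxt m k))"
        by (simp add: zscale_def DD_def ca_def cb_def algebra_simps)
      then show ?thesis
        using S lam[OF k] lam[OF nxt_in[OF k]] by (auto intro: Z.subspace_add Z.subspace_scale)
    qed
    have "(x, y) = zscale (\<Sum>k\<in>{1..m}. r k * DD m lam k) (x, y)"
      by (simp only: r) (simp add: zscale_def)
    also have "\<dots> = (\<Sum>k\<in>{1..m}. zscale (r k) (zscale (DD m lam k) (x, y)))"
      by (simp add: Z.scale_sum_left)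
    also have "\<dots> \<in> S"
      by (intro Z.subspace_sum[OF S] Z.subspace_scale[OF S, of "zscale _ _"] D)
    finally show ?thesis .
  qed
  then show thesis using that by (auto simp: S_def)
qed

text \<open>On the line through the characteristic vector of side \<open>k\<close> the two weights
  take the values \<open>(t, 0)\<close> at \<open>v\<^sub>k\<close> and \<open>(0, t)\<close> at the
  preceding vertex. So \<open>Edge k\<close> has the value \<open>t\<close> at both, and all other
  proper faces have the value 0 at both.\<close>

lemma ev_tau_line:
  assumes "m \<ge> 2" "characteristic_function m lam" "k \<in> {1..m}" "F \<in> faces m" "F \<noteq> Whole"
  shows "ev (tau m lam F (prv m k)) (of_int (ca lam k) * t) (of_int (cb lam k) * t)
    = ev (tau m lam F k) (of_int (ca lam k) * t) (of_int (cb lam k) * t)"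
proof -
  let ?x = "of_int (ca lam k) * t" and ?y = "of_int (cb lam k) * t"
  note p = prv_in[OF assms(3)] and np = nxt_prv[OF assms(3)]
  have v: "ev (yv m lam k) ?x ?y = t" "ev (zv m lam k) ?x ?y = 0"
    using ev_yv_zv[OF assms(2,3), where x = ?x and y = ?y and s = t and t = 0] by simp_all
  have pv: "ev (yv m lam (prv m k)) ?x ?y = 0" "ev (zv m lam (prv m k)) ?x ?y = t"
    using ev_yv_zv[OF assms(2) p, where x = ?x and y = ?y and s = 0 and t = t] by (simp_all add: np)
  show ?thesis
    using assms(4)
  proof (cases rule: face_cases)
    case (Vertex i)
    then show ?thesis by (simp add: tau_Vertex[OF assms(3)] tau_Vertex[OF p] v pv)
  next
    case (Edge i)
    then show ?thesis
      using prv_neq[OF assms(1,3)] v pv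
      by (auto simp: tau_Edge[OF assms(1,3)] tau_Edge[OF assms(1) p] np)
  qed (use assms(5) in simp)
qed

lemma ev_mu_line:
  assumes "m \<ge> 2" "characteristic_function m lam" "k \<in> {1..m}" "f \<in> PP m"
  shows "ev (mu m lam f (prv m k)) (of_int (ca lam k) * t) (of_int (cb lam k) * t)
    = ev (mu m lam f k) (of_int (ca lam k) * t) (of_int (cb lam k) * t)"
proof -
  have prod: "ev (prod g A) x y = (\<Prod>i\<in>A. ev (g i) x y)" for g A and x y :: rat
    by (simp add: ev_def poly_prod)
  show ?thesis
    unfolding mu_def ev_sum ev_simps prod
    using assms(4) ev_tau_line[OF assms(1-3)]
    by (intro sum.cong prod.cong refl arg_cong2[of _ _ _ _ "(*)"] arg_cong2[of _ _ _ _ power])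
      (auto simp: PP_def)
qed

lemma a_inv_face_poly_ring: "f \<in> PP m \<Longrightarrow> \<ominus>\<^bsub>face_poly_ring m\<^esub> f = - f"
proof -
  interpret cring "face_poly_ring m" by (rule face_poly_ring_cring)
  show "f \<in> PP m \<Longrightarrow> \<ominus>\<^bsub>face_poly_ring m\<^esub> f = - f"
    using minus_equality[of "- f" f] by (simp add: PP_uminus)
qed

section \<open>The ring of elements with integral restrictions\<close>

lemma ZGa_simps [simp]:
  "mult (ZGa m lam) = (*)" "one (ZGa m lam) = 1" "zero (ZGa m lam) = 0" "add (ZGa m lam) = (+)"
  by (simp_all add: ZGa_def)

lemma ZGa_add: "f \<in> carrier (ZGa m lam) \<Longrightarrow> g \<in> carrier (ZGa m lam) \<Longrightarrow> f + g \<in> carrier (ZGa m lam)"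
  and ZGa_mult: "f \<in> carrier (ZGa m lam) \<Longrightarrow> g \<in> carrier (ZGa m lam) \<Longrightarrow> f * g \<in> carrier (ZGa m lam)"
  and ZGa_uminus: "f \<in> carrier (ZGa m lam) \<Longrightarrow> - f \<in> carrier (ZGa m lam)"
  and ZGa_one: "1 \<in> carrier (ZGa m lam)"
proof -
  have r: "p + q \<in> range iota" "p * q \<in> range iota"
    if "p \<in> range iota" "q \<in> range iota" for p q
    using that by (auto simp flip: iota_add iota_mult)
  have u: "- p \<in> range iota" if "p \<in> range iota" for p
    using that by (auto simp flip: iota_uminus)
  show "f \<in> carrier (ZGa m lam) \<Longrightarrow> g \<in> carrier (ZGa m lam) \<Longrightarrow> f + g \<in> carrier (ZGa m lam)"
    "f \<in> carrier (ZGa m lam) \<Longrightarrow> g \<in> carrier (ZGa m lam) \<Longrightarrow> f * g \<in> carrier (ZGa m lam)"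
    "f \<in> carrier (ZGa m lam) \<Longrightarrow> - f \<in> carrier (ZGa m lam)"
    unfolding ZGa_iff using r u by (simp_all add: PP_add PP_mult PP_uminus)
  show "1 \<in> carrier (ZGa m lam)"
    unfolding ZGa_iff by (simp add: image_iff) (metis iota_1)
qed

lemma ZGa_ring: "ring (ZGa m lam)"
proof -
  interpret cring "face_poly_ring m" by (rule face_poly_ring_cring)
  have PP: "f \<in> PP m" if "f \<in> carrier (ZGa m lam)" for f using that by (simp add: ZGa_iff)
  have "subring (carrier (ZGa m lam)) (face_poly_ring m)"
    by (rule subringI) (simp_all add: subset_iff PP a_inv_face_poly_ring ZGa_add ZGa_mult ZGa_uminus ZGa_one)
  then have "ring ((face_poly_ring m)\<lparr>carrier := carrier (ZGa m lam)\<rparr>)"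
    by (rule subring_is_ring)
  moreover have "(face_poly_ring m)\<lparr>carrier := carrier (ZGa m lam)\<rparr> = ZGa m lam"
    by (simp add: ZGa_def)
  ultimately show ?thesis by simp
qed

lemma face_ideal_ideal_ZGa:
  assumes "m \<ge> 2"
  shows "ideal (face_ideal m) (ZGa m lam)"
proof -
  interpret ring "ZGa m lam" by (rule ZGa_ring)
  have sub: "face_ideal m \<subseteq> carrier (ZGa m lam)"
  proof
    fix f assume "f \<in> face_ideal m"
    then have "f \<in> PP m" "\<forall>v\<in>{1..m}. mu m lam f v = iota 0"
      using face_ideal_subset_kernel[OF assms, of lam] by auto
    then show "f \<in> carrier (ZGa m lam)" unfolding ZGa_iff by blast
  qed
  have PP: "f \<in> PP m" if "f \<in> carrier (ZGa m lam)" for f using that by (simp add: ZGa_iff)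
  have mult: "f * g \<in> face_ideal m" "g * f \<in> face_ideal m"
    if "g \<in> face_ideal m" "f \<in> carrier (ZGa m lam)" for f g
    using face_ideal_mult[OF assms PP that(1), OF that(2)] by (simp_all add: mult.commute)
  show ?thesis
  proof (rule idealI)
    show "subgroup (face_ideal m) (add_monoid (ZGa m lam))"
    proof
      fix f assume f: "f \<in> face_ideal m"
      have "inv\<^bsub>add_monoid (ZGa m lam)\<^esub> f = - f"
        using f sub minus_equality[of "- f" f] by (auto simp: a_inv_def ZGa_uminus)
      then show "inv\<^bsub>add_monoid (ZGa m lam)\<^esub> f \<in> face_ideal m"
        using f assms by (simp add: face_ideal_uminus)
    qed (use sub assms in \<open>auto simp: face_ideal_add face_ideal_zero\<close>)
  qed (simp_all add: ring_axioms mult)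
qed

section \<open>Piecewise polynomials and syzygies\<close>

lemma primitive_vector:
  assumes "(c::int, d::int) \<noteq> 0"
  obtains g a b x y where "c = g * a" "d = g * b" "g \<noteq> 0" "x * a + y * b = 1"
proof -
  let ?g = "gcd c d"
  have g: "?g \<noteq> 0" using assms by (auto simp: zero_prod_def)
  obtain x y where xy: "x * c + y * d = ?g" using bezout_int by blast
  obtain a b where ab: "c = ?g * a" "d = ?g * b" by (meson dvdE gcd_dvd1 gcd_dvd2)
  have "?g * (x * a + y * b) = x * (?g * a) + y * (?g * b)" by (simp add: algebra_simps)
  also have "\<dots> = ?g" using ab xy by simp
  finally have "x * a + y * b = 1" using g by (metis mult_cancel_left mult.right_neutral)
  with ab g that show thesis by blast
qed

lemma piecewise_difference_dvd:
  assumes m: "m \<ge> 2" and char: "characteristic_function m lam" and k: "k \<in> {1..m}"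
    and f: "f \<in> PP m" and p: "\<And>v. v \<in> {1..m} \<Longrightarrow> mu m lam f v = iota (p v)"
    and prim: "ca lam k = g * a" "cb lam k = g * b" "g \<noteq> 0" "x * a + y * b = 1"
  shows "lform a b dvd p k - p (prv m k)"
proof (rule lform_dvd[OF prim(4)])
  fix n
  \<comment> \<open>Chosen so that \<open>t \<lambda>\<^sub>k\<close> is the multiple
    \<open>n (a, b)\<close> of the primitive vector; it is fractional in general, hence the
    comparison along rational points of the line.\<close>
  define t where "t = rat_of_int n / of_int g"
  have t: "rat_of_int (ca lam k) * t = of_int (n * a)" "rat_of_int (cb lam k) * t = of_int (n * b)"
    using prim(3) by (simp_all add: t_def prim(1,2))
  have "ev (iota (p (prv m k))) (of_int (n * a)) (of_int (n * b)) =
      ev (iota (p k)) (of_int (n * a)) (of_int (n * b))"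
    using ev_mu_line[OF m char k f, of t] by (simp only: t p[OF k] p[OF prv_in[OF k]])
  then show "ev (p k - p (prv m k)) (n * a) (n * b) = 0"
    by (simp only: ev_iota of_int_eq_iff) simp
qed

text \<open>The closing condition makes the recursion cyclic: at \<open>k = 1\<close> it identifies
  the full sum with the empty one.\<close>

lemma psum_difference:
  assumes "m \<ge> 2" "k \<in> {1..m}" "psum l q m = 0"
  shows "psum l q k = psum l q (prv m k) + l k * q k"
proof (cases "k = 1")
  case True
  then show ?thesis using assms(3) by (simp add: psum_def prv_def)
next
  case False
  then obtain i where "k = Suc i" "i \<noteq> 0" using assms by (cases k) auto
  then show ?thesis by (simp add: psum_def prv_def)
qed

lemma psum_difference_eq:
  assumes diff: "\<And>k. k \<in> {1..m} \<Longrightarrow> p k - p (prv m k) = l k * q k" and k: "k \<in> {1..m}"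
  shows "p k = p m + psum l q k"
  using k
proof (induction k)
  case (Suc i)
  show ?case
  proof (cases "i = 0")
    case True
    then show ?thesis using diff[of 1] Suc.prems by (simp add: psum_def prv_def algebra_simps)
  next
    case False
    then have "p i = p m + psum l q i" using Suc by simp
    moreover have "p (Suc i) = p i + l (Suc i) * q (Suc i)"
      using diff[of "Suc i"] Suc.prems False by (simp add: prv_def algebra_simps)
    ultimately show ?thesis by (simp add: psum_def)
  qed
qed simp

theorem theorem5p2:
  fixes m :: nat and lam :: "nat \<Rightarrow> int \<times> int"
  assumes "m \<ge> 2"
    and "characteristic_function m lam"
    and "Modules.module.span zscale (lam ` {1..m}) = UNIV \<or> Gcd (DD m lam ` {1..m}) = 1"
  shows "generate_ring (weighted_face_ring m lam)
           (face_class m lam ` (generators2 m lam \<union> generators4 m lam))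
         = carrier (weighted_face_ring m lam)"
proof -
  note m = assms(1) and char = assms(2)
  let ?R = "ZGa m lam" and ?W = "weighted_face_ring m lam" and ?\<phi> = "face_class m lam"
    and ?G = "generators2 m lam \<union> generators4 m lam"
  let ?S = "generate_ring ?W (?\<phi> ` ?G)"
  interpret R: ring ?R by (rule ZGa_ring)
  interpret I: ideal "face_ideal m" ?R by (rule face_ideal_ideal_ZGa[OF m])
  interpret W: ring ?W unfolding weighted_face_ring_def by (rule I.quotient_is_ring)
  have \<phi>: "?\<phi> = (+>\<^bsub>?R\<^esub>) (face_ideal m)" by (simp add: face_class_def fun_eq_iff)
  interpret h: ring_hom_ring ?R ?W ?\<phi>
    unfolding \<phi> weighted_face_ring_def by (rule I.rcos_ring_hom_ring)
  have uminus: "\<ominus>\<^bsub>?R\<^esub> f = - f" if "f \<in> carrier ?R" for f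
    using that R.minus_equality[of "- f" f] by (simp add: ZGa_uminus)
  have G: "?G \<subseteq> carrier ?R"
    unfolding generators2_eq generators4_eq using gen2_in_ZGa[OF m char] gen4_in_ZGa[OF m char] by blast

  \<comment> \<open>The preimage of the generated subring. Working here allows representatives to be
    added and multiplied as polynomials instead of cosets.\<close>
  define H where "H = {g \<in> carrier ?R. ?\<phi> g \<in> ?S}"
  have H_gen: "g \<in> H" if "g \<in> ?G" for g
    using that G by (auto simp: H_def intro: generate_ring.incl)
  have H_add: "f + g \<in> H" and H_mult: "f * g \<in> H" and H_uminus: "- f \<in> H"
    if "f \<in> H" "g \<in> H" for f g
    using that h.hom_add[of f g] h.hom_mult[of f g] h.hom_a_inv[of f] uminus[of f]
    by (auto simp: H_def ZGa_add ZGa_mult ZGa_uminus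
        intro: generate_ring.eng_add generate_ring.eng_mult generate_ring.a_inv)
  have H_one: "1 \<in> H"
    using h.hom_one by (auto simp: H_def ZGa_one intro: generate_ring.one)
  have "1 + - 1 \<in> H" using H_one by (intro H_add H_uminus)
  then have H_of_nat: "of_nat n \<in> H" for n
    by (induction n) (simp_all add: H_add H_one)
  have H_of_int: "of_int n \<in> H" for n
    by (cases n rule: int_cases2) (use H_of_nat H_uminus in auto)

  define T where "T p \<longleftrightarrow> (\<exists>g\<in>H. \<forall>v\<in>{1..m}. mu m lam g v = iota (p v))" for p :: "nat \<Rightarrow> int poly poly"
  have T_cong: "T p \<Longrightarrow> T q" if "\<And>k. k \<in> {1..m} \<Longrightarrow> p k = q k" for p q
    using that by (auto simp: T_def)
  have T_add: "T (\<lambda>k. p k + q k)" if "T p" "T q" for p q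
    using that H_add unfolding T_def by (metis iota_add mu_add)
  have T_mult: "T (\<lambda>k. p k * q k)" if "T p" "T q" for p q
    using that H_mult unfolding T_def by (metis iota_mult mu_mult)
  have T_linear: "T (\<lambda>k. of_int (r k) * E1 + of_int (s k) * E2)"
    if "\<And>k. k \<in> {1..m} \<Longrightarrow>
      r (prv m k) * ca lam k + s (prv m k) * cb lam k = r k * ca lam k + s k * cb lam k" for r s
    using piecewise_linear_generator[OF m char that] H_gen unfolding T_def by (metis UnI1)
  have T_quadratic: "T (\<lambda>k. of_int (r k) * E1 ^ 2 + of_int (s k) * (E1 * E2) + of_int (t k) * E2 ^ 2)"
    if "\<And>k. k \<in> {1..m} \<Longrightarrow>
      r (prv m k) * ca lam k ^ 2 + s (prv m k) * (ca lam k * cb lam k) + t (prv m k) * cb lam k ^ 2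
      = r k * ca lam k ^ 2 + s k * (ca lam k * cb lam k) + t k * cb lam k ^ 2" for r s t
    using piecewise_quadratic_generator[OF m char that] H_gen unfolding T_def by (metis UnI2)
  have T_const: "T (\<lambda>_. p)" for p
  proof (induction p rule: int_poly_poly_induct)
    case E1
    show ?case using T_linear[of "\<lambda>_. 1" "\<lambda>_. 0"] by simp
  next
    case E2
    show ?case using T_linear[of "\<lambda>_. 0" "\<lambda>_. 1"] by simp
  next
    case (of_int c)
    show ?case unfolding T_def using H_of_int[of c] by (intro bexI[of _ "of_int c"]) simp_all
  qed (use T_add T_mult in auto)

  have "\<forall>k\<in>{1..m}. \<exists>g a b x y. ca lam k = g * a \<and> cb lam k = g * b \<and> g \<noteq> 0 \<and> x * a + y * b = 1"
  proof
    fix k assume "k \<in> {1..m}"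
    then have "(ca lam k, cb lam k) \<noteq> 0"
      using char by (simp add: characteristic_function_def ca_def cb_def)
    then show "\<exists>g a b x y. ca lam k = g * a \<and> cb lam k = g * b \<and> g \<noteq> 0 \<and> x * a + y * b = 1"
      by (rule primitive_vector) blast
  qed
  then obtain g a b x y where prim: "\<And>k. k \<in> {1..m} \<Longrightarrow>
      ca lam k = g k * a k \<and> cb lam k = g k * b k \<and> g k \<noteq> 0 \<and> x k * a k + y k * b k = 1"
    by metis
  define l where "l k = lform (a k) (b k)" for k
  have gl: "of_int (g k) * l k = of_int (cb lam k) * E1 - of_int (ca lam k) * E2" if "k \<in> {1..m}" for k
    using prim[OF that] by (simp add: l_def lform_def algebra_simps)
  have line: "b k * ca lam k - a k * cb lam k = 0" if "k \<in> {1..m}" for k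
    using prim[OF that] by simp

  \<comment> \<open>The form attached to a vector \<open>(p, q)\<close> is
    \<open>q E1 - p E2\<close>, so the vectors \<open>(0, 1)\<close> here and \<open>(-1, 0)\<close>
    below yield the forms \<open>E1\<close> and \<open>E2\<close>.\<close>
  obtain u where u: "(\<Sum>k\<in>{1..m}. u k * ca lam k) = 0" "(\<Sum>k\<in>{1..m}. u k * cb lam k) = 1"
    using characteristic_vectors_span[OF assms(3)] by blast
  obtain w where w: "(\<Sum>k\<in>{1..m}. w k * ca lam k) = - 1" "(\<Sum>k\<in>{1..m}. w k * cb lam k) = 0"
    using characteristic_vectors_span[OF assms(3)] by blast
  have comb: "(\<Sum>k\<in>{1..m}. of_int (v k * g k) * l k) =
      of_int (\<Sum>k\<in>{1..m}. v k * cb lam k) * E1 - of_int (\<Sum>k\<in>{1..m}. v k * ca lam k) * E2" for v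
  proof -
    have "(\<Sum>k\<in>{1..m}. of_int (v k * g k) * l k) =
        (\<Sum>k\<in>{1..m}. of_int (v k * cb lam k) * E1 - of_int (v k * ca lam k) * E2)"
      by (rule sum.cong) (simp_all add: mult.assoc gl right_diff_distrib del: atLeastAtMost_iff)
    then show ?thesis by (simp add: sum_subtractf sum_distrib_right)
  qed
  \<comment> \<open>The factor \<open>g k\<close> converts coefficients of the characteristic
    vectors into coefficients of the primitive forms \<open>l k\<close>.\<close>
  define U where "U k = u k * g k" for k
  define V where "V k = w k * g k" for k
  have U: "(\<Sum>k\<in>{1..m}. of_int (U k) * l k) = E1" and V: "(\<Sum>k\<in>{1..m}. of_int (V k) * l k) = E2"
    unfolding U_def V_def comb using u w by simp_all

  have T_psum_linear: "T (psum l (\<lambda>k. of_int (n k)))" if "psum l (\<lambda>k. of_int (n k)) m = 0" for n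
  proof -
    define r where "r k = (\<Sum>j\<in>{1..k}. n j * b j)" for k
    define s where "s k = - (\<Sum>j\<in>{1..k}. n j * a j)" for k
    have p: "psum l (\<lambda>k. of_int (n k)) k = of_int (r k) * E1 + of_int (s k) * E2" for k
      by (simp add: psum_def l_def lform_def r_def s_def sum_distrib_left sum_subtractf algebra_simps)
    \<comment> \<open>The jump across side \<open>k\<close> is a multiple of \<open>l k\<close>,
      which vanishes on the characteristic vector of that side.\<close>
    have compat: "r (prv m k) * ca lam k + s (prv m k) * cb lam k = r k * ca lam k + s k * cb lam k"
      if k: "k \<in> {1..m}" for k
    proof -
      have "ev (psum l (\<lambda>k. of_int (n k)) k) (ca lam k) (cb lam k) =
          ev (psum l (\<lambda>k. of_int (n k)) (prv m k)) (ca lam k) (cb lam k)"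
        using psum_difference[OF m k \<open>psum l (\<lambda>k. of_int (n k)) m = 0\<close>] line[OF k]
        by (simp add: l_def)
      then show ?thesis by (simp add: p)
    qed
    show ?thesis by (rule T_cong[OF p[symmetric] T_linear[OF compat]])
  qed

  have T_koszul: "T (psum l (\<lambda>k. of_int (V k) * E1 - of_int (U k) * E2))"
  proof -
    let ?q = "\<lambda>k. of_int (V k) * E1 - of_int (U k) * E2"
    \<comment> \<open>Coefficients of the partial sums of
      \<open>(b E1 - a E2) (V E1 - U E2)\<close>, expanded as quadratic forms.\<close>
    define r where "r k = (\<Sum>j\<in>{1..k}. V j * b j)" for k
    define s where "s k = - (\<Sum>j\<in>{1..k}. V j * a j + U j * b j)" for k
    define t where "t k = (\<Sum>j\<in>{1..k}. U j * a j)" for k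
    have p: "psum l ?q k = of_int (r k) * E1 ^ 2 + of_int (s k) * (E1 * E2) + of_int (t k) * E2 ^ 2" for k
      by (simp add: psum_def l_def lform_def r_def s_def t_def sum_distrib_left sum_subtractf sum.distrib
          algebra_simps power2_eq_square)
    \<comment> \<open>By \<open>U\<close> and \<open>V\<close> the two sums are \<open>E1\<close>
      and \<open>E2\<close>, so this is \<open>E1 * E2 - E2 * E1\<close>: the closing condition is
      the commutativity of the two variables.\<close>
    have "psum l ?q m = E1 * (\<Sum>k\<in>{1..m}. of_int (V k) * l k) - E2 * (\<Sum>k\<in>{1..m}. of_int (U k) * l k)"
      by (simp add: psum_def sum_distrib_left sum_subtractf algebra_simps)
    then have 0: "psum l ?q m = 0" unfolding U V by (simp add: mult.commute)
    have compat: "r (prv m k) * ca lam k ^ 2 + s (prv m k) * (ca lam k * cb lam k) + t (prv m k) * cb lam k ^ 2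
      = r k * ca lam k ^ 2 + s k * (ca lam k * cb lam k) + t k * cb lam k ^ 2"
      if k: "k \<in> {1..m}" for k
    proof -
      have "ev (psum l ?q k) (ca lam k) (cb lam k) = ev (psum l ?q (prv m k)) (ca lam k) (cb lam k)"
        using psum_difference[OF m k 0] line[OF k] by (simp add: l_def)
      then show ?thesis by (simp add: p)
    qed
    show ?thesis by (rule T_cong[OF p[symmetric] T_quadratic[OF compat]])
  qed

  have T_psum: "T (psum l q)" if "psum l q m = 0" for q
  proof (rule psum_syzygy[where m = m and l = l and T = T and a = a and b = b and U = U and W = V])
    show "l k = lform (a k) (b k)" for k by (rule l_def)
    show "T q" if "\<And>k. k \<in> {1..m} \<Longrightarrow> p k = q k" "T p" for p q using that by (rule T_cong)
    show "T (\<lambda>k. p k + q k)" if "T p" "T q" for p q using that by (rule T_add)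
    show "T (\<lambda>k. p k * q k)" if "T p" "T q" for p q using that by (rule T_mult)
    show "T (psum l (\<lambda>k. of_int (n k)))" if "psum l (\<lambda>k. of_int (n k)) m = 0" for n
      using that by (rule T_psum_linear)
  qed (fact T_const U V T_koszul that)+

  have "?\<phi> f \<in> ?S" if f: "f \<in> carrier ?R" for f
  proof -
    have fP: "f \<in> PP m" using f by (simp add: ZGa_iff)
    have "\<forall>v\<in>{1..m}. \<exists>p. mu m lam f v = iota p" using f by (auto simp: ZGa_iff)
    then obtain p where p: "\<And>v. v \<in> {1..m} \<Longrightarrow> mu m lam f v = iota (p v)" by metis
    have "\<forall>k\<in>{1..m}. \<exists>q. p k - p (prv m k) = l k * q"
      using piecewise_difference_dvd[OF m char _ fP p] prim unfolding l_def dvd_def by meson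
    then obtain q where q: "\<And>k. k \<in> {1..m} \<Longrightarrow> p k - p (prv m k) = l k * q k" by metis
    have pq: "p k = p m + psum l q k" if "k \<in> {1..m}" for k
      using psum_difference_eq[of m p l q, OF q that] by blast
    have "psum l q m = 0" using pq[of m] m by simp
    then have "T (\<lambda>k. p m + psum l q k)" by (intro T_add T_const T_psum)
    from T_cong[OF pq[symmetric] this] have "T p" .
    then obtain g where g: "g \<in> H" "\<And>v. v \<in> {1..m} \<Longrightarrow> mu m lam g v = iota (p v)"
      unfolding T_def by blast
    have gR: "g \<in> carrier ?R" using g(1) by (simp add: H_def)
    then have "f - g \<in> PP m" using fP by (simp add: ZGa_iff PP_diff)
    \<comment> \<open>\<open>f\<close> and \<open>g\<close> agree at every vertex; the exact kernel
      turns this into equality of classes.\<close>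
    then have "f - g \<in> face_ideal m"
      unfolding face_ideal_eq_kernel[OF m char] using p g(2) by simp
    then have "?\<phi> f = ?\<phi> g"
      using R.quotient_eq_iff_same_a_r_cos[OF I.ideal_axioms f gR] uminus[OF gR]
      by (simp add: a_minus_def face_class_def)
    then show ?thesis using g(1) by (simp add: H_def)
  qed
  moreover have "carrier ?W = ?\<phi> ` carrier ?R"
    by (auto simp: weighted_face_ring_def FactRing_def A_RCOSETS_def' face_class_def)
  ultimately have "carrier ?W \<subseteq> ?S" by (simp add: image_subset_iff)
  moreover have "?S \<subseteq> carrier ?W"
    by (rule W.generate_ring_incl) (use subsetD[OF G] h.hom_closed in \<open>simp add: image_subset_iff\<close>)
  ultimately show ?thesis by blast
qed

end
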